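(* Let $T>0$, let $m,n\ge1$ be integers, and let $S,N\in O(m)$ satisfy $S^n=I_m$ and $N^2=(NS)^2=I_m$, acting dihedrally on $T$-periodic functions by $(\mathcal Su)(t)=Su(t+T/n)$ and $(\mathcal Nu)(t)=Nu(T/n-t)$. Let $L=L(t,x,v)$ be a $C^2$ Lagrangian on $\mathbb R\times\mathbb R^m\times\mathbb R^m$ satisfying the Legendre convexity condition and the symmetries $L(t,x,v)=L(t-T/n,Sx,Sv)$ and $L(t,x,v)=L(T/n-t,Nx,Nv)$, and let $x$ be a $D_n$-equivariant $T$-periodic critical point of the action $\int_0^TL(t,x,\dot x)\,dt$. Let $\mathcal A$ be the Sturm operator obtained by linearizing the Euler–Lagrange equation along $x$. If the restriction of $\mathcal A$ to $$E^2(T/(2n))=\{u\in W^{2,2}([0,T/(2n)],\mathbb C^m):\dot u(0)=\dot u(T/(2n))=0\}$$ is positive semi-definite, then $x$ cannot be strongly stable.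
   Context: Legendre convexity: $\langle D^2_{vv}L(t,q,v)w,w\rangle>0$ for all $t,q,v$ and all $w\in\mathbb R^m\setminus\{0\}$. $D_n$-equivariant means $\mathcal Sx=x$ and $\mathcal Nx=x$. Along $(t,x(t),\dot x(t))$ set $P=\partial^2L/\partial v^2$, $Q=\big(\partial^2L/\partial v_i\partial x_j\big)_{ij}$, $R=\partial^2L/\partial x^2$, and $$\mathcal A\xi=-\frac{d}{dt}\big(P(t)\dot\xi+Q(t)\xi\big)+Q(t)^{\mathsf T}\dot\xi+R(t)\xi.$$ Positive semi-definite on $E^2(T/(2n))$ means $\int_0^{T/(2n)}\langle\mathcal Au,u\rangle\,dt\ge0$ for all $u$ in that space. By the Legendre transform, the equation $\mathcal A\xi=0$ reduces to the linear Hamiltonian system $\dot z=JB(t)z$, $t\in[0,T]$, with $J=\begin{bmatrix}0&-I\\ I&0\end{bmatrix}$ and $$B(t)=\begin{bmatrix}P^{-1}&-P^{-1}Q\\-Q^{\mathsf T}P^{-1}&Q^{\mathsf T}P^{-1}Q-R\end{bmatrix}.$$ Let $\gamma$ be its fundamental solution ($\gamma(0)=I$) and $M_T=\gamma(T)\in\mathrm{Sp}(2m)$ the monodromy matrix. A symplectic matrix $M$ is linearly stable if $\sup_{k\in\mathbb Z}\|M^k\|<\infty$. The orbit $x$ is strongly stable if there is $\varepsilon>0$ such that every symplectic matrix in the $\varepsilon$-neighbourhood of $M_T$ in $\mathrm{Sp}(2m)$ (operator norm topology) is linearly stable.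
   Formalization: The time-reversal symmetry is taken as L(t,x,v)=L(T/n−t,Nx,−Nv); with the printed Nv the claim fails (m=n=1, S=N=1, T=2π, L=v²/2+c·cos(t)xv, x=0, small c>0). ∫⟨Au,u⟩ is read by parts with boundary terms kept, as Au need not be a function. *)

theory Defs
  imports "HOL-Analysis.Analysis"
begin

section \<open>Matrices\<close>

text \<open>Powers have to be introduced here: \<open>^\<close> on \<open>real^'n^'n\<close> is not the matrix power.\<close>

definition mat_pow :: "real^'n^'n \<Rightarrow> nat \<Rightarrow> real^'n^'n" where
  "mat_pow A k = (((**) A) ^^ k) (mat 1)"

definition mat_zpow :: "real^'n^'n \<Rightarrow> int \<Rightarrow> real^'n^'n" where
  "mat_zpow A k = (if 0 \<le> k then mat_pow A (nat k) else mat_pow (matrix_inv A) (nat (- k)))"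

abbreviation op_norm :: "real^'n^'n \<Rightarrow> real" where
  "op_norm A \<equiv> onorm ((*v) A)"

definition block_mat ::
  "real^'m^'m \<Rightarrow> real^'m^'m \<Rightarrow> real^'m^'m \<Rightarrow> real^'m^'m \<Rightarrow> real^('m + 'm)^('m + 'm)" where
  "block_mat A B C D = (\<chi> i j.
     case i of
       Inl a \<Rightarrow> (case j of Inl b \<Rightarrow> A $ a $ b | Inr b \<Rightarrow> B $ a $ b)
     | Inr a \<Rightarrow> (case j of Inl b \<Rightarrow> C $ a $ b | Inr b \<Rightarrow> D $ a $ b))"

definition J_mat :: "real^('m::finite + 'm)^('m + 'm)" where
  "J_mat = block_mat 0 (- mat 1) (mat 1) 0"

definition symplectic :: "real^('m::finite + 'm)^('m + 'm) \<Rightarrow> bool" where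
  "symplectic M \<longleftrightarrow> transpose M ** J_mat ** M = J_mat"

definition linearly_stable :: "real^'k^'k \<Rightarrow> bool" where
  "linearly_stable M \<longleftrightarrow> bdd_above (range (\<lambda>k::int. op_norm (mat_zpow M k)))"

definition strongly_stable_mat :: "real^('m::finite + 'm)^('m + 'm) \<Rightarrow> bool" where
  "strongly_stable_mat M \<longleftrightarrow>
     (\<exists>\<epsilon>>0. \<forall>M'. symplectic M' \<and> op_norm (M' - M) < \<epsilon> \<longrightarrow> linearly_stable M')"


section \<open>Lagrangians and their critical points\<close>

text \<open>A Lagrangian is a function of the triple \<open>(t, x, v)\<close>.\<close>

type_synonym 'm lagrangian = "real \<times> (real^'m) \<times> (real^'m) \<Rightarrow> real"

definition C2 :: "('a::real_normed_vector \<Rightarrow> real) \<Rightarrow> bool" where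
  "C2 f \<longleftrightarrow> (\<exists>(f' :: 'a \<Rightarrow> 'a \<Rightarrow>\<^sub>L real) (f'' :: 'a \<Rightarrow> 'a \<Rightarrow>\<^sub>L ('a \<Rightarrow>\<^sub>L real)).
     (\<forall>z. (f has_derivative blinfun_apply (f' z)) (at z)) \<and>
     (\<forall>z. (f' has_derivative blinfun_apply (f'' z)) (at z)) \<and>
     continuous_on UNIV f'')"

text \<open>\<open>D2 f z a b\<close> is \<open>\<partial>\<^sub>a \<partial>\<^sub>b f\<close> at \<open>z\<close>.\<close>

definition D2 :: "('a::real_normed_vector \<Rightarrow> real) \<Rightarrow> 'a \<Rightarrow> 'a \<Rightarrow> 'a \<Rightarrow> real" where
  "D2 f z a b = frechet_derivative (\<lambda>y. frechet_derivative f (at y) b) (at z) a"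

abbreviation x_dir :: "'m \<Rightarrow> real \<times> (real^'m) \<times> (real^'m)" where
  "x_dir i \<equiv> (0, axis i 1, 0)"

abbreviation v_dir :: "'m \<Rightarrow> real \<times> (real^'m) \<times> (real^'m)" where
  "v_dir i \<equiv> (0, 0, axis i 1)"

definition L_vv :: "'m::finite lagrangian \<Rightarrow> real \<times> (real^'m) \<times> (real^'m) \<Rightarrow> real^'m^'m" where
  "L_vv L z = (\<chi> i j. D2 L z (v_dir i) (v_dir j))"

definition L_vx :: "'m::finite lagrangian \<Rightarrow> real \<times> (real^'m) \<times> (real^'m) \<Rightarrow> real^'m^'m" where
  "L_vx L z = (\<chi> i j. D2 L z (v_dir i) (x_dir j))"

definition L_xx :: "'m::finite lagrangian \<Rightarrow> real \<times> (real^'m) \<times> (real^'m) \<Rightarrow> real^'m^'m" where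
  "L_xx L z = (\<chi> i j. D2 L z (x_dir i) (x_dir j))"

definition legendre_convex :: "'m::finite lagrangian \<Rightarrow> bool" where
  "legendre_convex L \<longleftrightarrow> (\<forall>t q v w. w \<noteq> 0 \<longrightarrow> 0 < (L_vv L (t, q, v) *v w) \<bullet> w)"

definition action :: "'m::finite lagrangian \<Rightarrow> real \<Rightarrow> (real \<Rightarrow> real^'m) \<Rightarrow> real" where
  "action L T u = integral {0..T} (\<lambda>t. L (t, u t, vector_derivative u (at t)))"

definition C1_loop :: "real \<Rightarrow> (real \<Rightarrow> real^'m) \<Rightarrow> bool" where
  "C1_loop T u \<longleftrightarrow> u C1_differentiable_on UNIV \<and> (\<forall>t. u (t + T) = u t)"

definition critical_loop :: "'m::finite lagrangian \<Rightarrow> real \<Rightarrow> (real \<Rightarrow> real^'m) \<Rightarrow> bool" where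
  "critical_loop L T x \<longleftrightarrow> C1_loop T x \<and>
     (\<forall>h. C1_loop T h \<longrightarrow>
        ((\<lambda>s. action L T (\<lambda>t. x t + s *\<^sub>R h t)) has_real_derivative 0) (at 0))"

text \<open>The two generators act on loops by \<open>S_act S (T/n)\<close> and \<open>N_act N (T/n)\<close>. The latter
  reverses time, so it sends the velocity \<open>u' t\<close> to \<open>- N u' (T/n - t)\<close>; the action is
  invariant when \<open>L (t, q, v) = L (T/n - t, N q, - N v)\<close>.\<close>

definition S_act :: "real^'m^'m \<Rightarrow> real \<Rightarrow> (real \<Rightarrow> real^'m) \<Rightarrow> real \<Rightarrow> real^'m" where
  "S_act S \<tau> u = (\<lambda>t. S *v u (t + \<tau>))"

definition N_act :: "real^'m^'m \<Rightarrow> real \<Rightarrow> (real \<Rightarrow> real^'m) \<Rightarrow> real \<Rightarrow> real^'m" where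
  "N_act N \<tau> u = (\<lambda>t. N *v u (\<tau> - t))"


section \<open>The Sturm operator\<close>

definition lift :: "(real \<Rightarrow> real^'m) \<Rightarrow> real \<Rightarrow> real \<times> (real^'m) \<times> (real^'m)" where
  "lift x t = (t, x t, vector_derivative x (at t))"

definition cinner :: "complex^'m \<Rightarrow> complex^'m \<Rightarrow> complex" where
  "cinner a b = (\<Sum>i\<in>UNIV. a $ i * cnj (b $ i))"

abbreviation cmul :: "real^'m^'m \<Rightarrow> complex^'m \<Rightarrow> complex^'m"  (infixl \<open>*c\<close> 70) where
  "A *c u \<equiv> map_matrix complex_of_real A *v u"

text \<open>\<open>W\<^sup>2\<^sup>,\<^sup>2\<close> on an interval, in terms of the \<open>C\<^sup>1\<close> representative: the derivative is the
  indefinite integral of a square integrable function. Derivatives at the end points are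
  one-sided.\<close>

abbreviation deriv_on :: "real \<Rightarrow> real \<Rightarrow> (real \<Rightarrow> 'a::real_normed_vector) \<Rightarrow> real \<Rightarrow> 'a" where
  "deriv_on a b u t \<equiv> vector_derivative u (at t within {a..b})"

definition W22 :: "real \<Rightarrow> real \<Rightarrow> (real \<Rightarrow> complex^'m) set" where
  "W22 a b = {u. (\<forall>t\<in>{a..b}. u differentiable (at t within {a..b})) \<and>
     (\<exists>w. w absolutely_integrable_on {a..b} \<and>
          (\<lambda>t. (norm (w t))\<^sup>2) integrable_on {a..b} \<and>
          (\<forall>t\<in>{a..b}. (w has_integral (deriv_on a b u t - deriv_on a b u a)) {a..t}))}"

definition E2 :: "real \<Rightarrow> (real \<Rightarrow> complex^'m) set" where
  "E2 \<tau> = {u \<in> W22 0 \<tau>. deriv_on 0 \<tau> u 0 = 0 \<and> deriv_on 0 \<tau> u \<tau> = 0}"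

definition momentum ::
  "(real \<Rightarrow> real^'m^'m) \<Rightarrow> (real \<Rightarrow> real^'m^'m) \<Rightarrow> real \<Rightarrow>
   (real \<Rightarrow> complex^'m) \<Rightarrow> real \<Rightarrow> complex^'m" where
  "momentum P Q \<tau> u t = P t *c deriv_on 0 \<tau> u t + Q t *c u t"

text \<open>
  \<open>sturm_pairing P Q R \<tau> u\<close> is the integral over \<open>[0, \<tau>]\<close> of \<open>\<langle>\<A>u, u\<rangle>\<close>, where
  \<open>\<A>u = - d/dt (P u' + Q u) + Q\<^sup>T u' + R u\<close>. A \<open>C\<^sup>2\<close> Lagrangian only gives continuous
  \<open>P\<close> and \<open>Q\<close>, so \<open>P u' + Q u\<close> need not be differentiable for \<open>u\<close> in \<open>W\<^sup>2\<^sup>,\<^sup>2\<close>. The derivative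
  is therefore moved to the second argument, keeping the boundary terms. Lemma
  \<open>sturm_pairing_eq_integral\<close> below shows that this is the integral of \<open>\<langle>\<A>u, u\<rangle>\<close>
  itself whenever \<open>P u' + Q u\<close> is absolutely continuous, i.e. whenever \<open>\<A>u\<close> is a function.
\<close>

definition sturm_pairing ::
  "(real \<Rightarrow> real^'m^'m) \<Rightarrow> (real \<Rightarrow> real^'m^'m) \<Rightarrow> (real \<Rightarrow> real^'m^'m) \<Rightarrow> real \<Rightarrow>
   (real \<Rightarrow> complex^'m) \<Rightarrow> complex" where
  "sturm_pairing P Q R \<tau> u =
     integral {0..\<tau>} (\<lambda>t. cinner (momentum P Q \<tau> u t) (deriv_on 0 \<tau> u t)
       + cinner (transpose (Q t) *c deriv_on 0 \<tau> u t + R t *c u t) (u t))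
     - (cinner (momentum P Q \<tau> u \<tau>) (u \<tau>) - cinner (momentum P Q \<tau> u 0) (u 0))"

definition sturm_psd_on_E2 ::
  "'m::finite lagrangian \<Rightarrow> (real \<Rightarrow> real^'m) \<Rightarrow> real \<Rightarrow> bool" where
  "sturm_psd_on_E2 L x \<tau> \<longleftrightarrow>
     (\<forall>u\<in>E2 \<tau>. sturm_pairing (\<lambda>t. L_vv L (lift x t)) (\<lambda>t. L_vx L (lift x t))
        (\<lambda>t. L_xx L (lift x t)) \<tau> u \<in> \<real>\<^sub>\<ge>\<^sub>0)"


section \<open>The linear Hamiltonian system\<close>

definition B_mat :: "real^'m^'m \<Rightarrow> real^'m^'m \<Rightarrow> real^'m^'m \<Rightarrow> real^('m::finite + 'm)^('m + 'm)" where
  "B_mat P Q R = block_mat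
     (matrix_inv P)                       (- (matrix_inv P ** Q))
     (- (transpose Q ** matrix_inv P))    (transpose Q ** matrix_inv P ** Q - R)"

definition B_along ::
  "'m::finite lagrangian \<Rightarrow> (real \<Rightarrow> real^'m) \<Rightarrow> real \<Rightarrow> real^('m + 'm)^('m + 'm)" where
  "B_along L x t = B_mat (L_vv L (lift x t)) (L_vx L (lift x t)) (L_xx L (lift x t))"

definition fundamental_solution ::
  "(real \<Rightarrow> real^('m::finite + 'm)^('m + 'm)) \<Rightarrow> real \<Rightarrow>
   (real \<Rightarrow> real^('m + 'm)^('m + 'm)) \<Rightarrow> bool" where
  "fundamental_solution B T \<gamma> \<longleftrightarrow> \<gamma> 0 = mat 1 \<and>
     (\<forall>t\<in>{0..T}. (\<gamma> has_vector_derivative (J_mat ** B t ** \<gamma> t)) (at t within {0..T}))"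

text \<open>\<open>B_along L x\<close> is continuous, so there is exactly one \<open>\<gamma>\<close> (up to values outside \<open>[0, T]\<close>).\<close>

definition strongly_stable_orbit :: "'m::finite lagrangian \<Rightarrow> real \<Rightarrow> (real \<Rightarrow> real^'m) \<Rightarrow> bool" where
  "strongly_stable_orbit L T x \<longleftrightarrow>
     (\<exists>\<gamma>. fundamental_solution (B_along L x) T \<gamma> \<and> strongly_stable_mat (\<gamma> T))"


section \<open>The pairing is the integral of \<open>\<langle>\<A>u, u\<rangle>\<close>\<close>

lemma bounded_bilinear_cinner: "bounded_bilinear cinner"
proof (rule bounded_bilinear.intro)
  show "\<exists>K. \<forall>a b :: complex^'m. norm (cinner a b) \<le> norm a * norm b * K"
  proof (intro exI allI)
    fix a b :: "complex^'m"
    have "norm (cinner a b) \<le> (\<Sum>i\<in>UNIV. norm (a $ i * cnj (b $ i)))"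
      unfolding cinner_def by (rule norm_sum)
    also have "\<dots> \<le> (\<Sum>i\<in>(UNIV::'m set). norm a * norm b)"
      by (intro sum_mono) (simp add: norm_mult mult_mono Finite_Cartesian_Product.norm_nth_le)
    finally show "norm (cinner a b) \<le> norm a * norm b * real CARD('m)"
      by (simp add: mult.commute)
  qed
qed (simp_all add: cinner_def sum.distrib algebra_simps scaleR_sum_right)

text \<open>Integration by parts for an absolutely continuous factor.\<close>

lemma has_integral_by_parts_ac:
  fixes p q :: "real \<Rightarrow> 'a::euclidean_space" and u u' :: "real \<Rightarrow> 'b::euclidean_space"
    and h :: "'a \<Rightarrow> 'b \<Rightarrow> 'c::euclidean_space"
  assumes h: "bounded_bilinear h" and ab: "a < b"
    and u: "\<And>t. t \<in> {a..b} \<Longrightarrow> (u has_vector_derivative u' t) (at t within {a..b})"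
    and u': "continuous_on {a..b} u'"
    and q: "q absolutely_integrable_on {a..b}"
    and p: "\<And>t. t \<in> {a..b} \<Longrightarrow> (q has_integral (p t - p a)) {a..t}"
  shows "((\<lambda>t. h (q t) (u t) + h (p t) (u' t)) has_integral (h (p b) (u b) - h (p a) (u a))) {a..b}"
proof -
  interpret h: bounded_bilinear h by (rule h)
  define f where "f = (\<lambda>t. h (q t) (u t) + h (p t) (u' t))"
  have contu: "continuous_on {a..b} u"
    using u has_vector_derivative_continuous continuous_on_eq_continuous_within by blast
  have qint: "q integrable_on {a..b}"
    using q absolutely_integrable_on_def by blast
  have nqint: "(\<lambda>t. norm (q t)) integrable_on {a..b}"
    using q absolutely_integrable_on_def by blast
  have peq: "p t = p a + integral {a..t} q" if "t \<in> {a..b}" for t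
    using p[OF that] by (simp add: integral_unique)
  have "continuous_on {a..b} (\<lambda>t. p a + integral {a..t} q)"
    by (intro continuous_intros indefinite_integral_continuous_1 qint)
  then have contp: "continuous_on {a..b} p"
    by (rule continuous_on_eq) (metis peq)
  have absint_prod: "(\<lambda>t. h (q t) (g t)) integrable_on {c..d}"
    if g: "continuous_on {a..b} g" and cd: "a \<le> c" "d \<le> b" for g c d
  proof -
    have "bilinear (\<lambda>x y. h y x)"
      using h.flip bilinear_conv_bounded_bilinear by blast
    moreover have "g \<in> borel_measurable (lebesgue_on {a..b})"
      using g by (intro continuous_imp_measurable_on_sets_lebesgue) auto
    moreover have "bounded (g ` {a..b})"
      using g by (intro compact_imp_bounded compact_continuous_image) auto
    ultimately have "(\<lambda>t. h (q t) (g t)) absolutely_integrable_on {a..b}"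
      using absolutely_integrable_bounded_measurable_product[of "\<lambda>x y. h y x" g "{a..b}" q] q by auto
    then show ?thesis
      using cd by (auto simp: absolutely_integrable_on_def intro: integrable_subinterval_real)
  qed
  have contpu': "continuous_on {a..b} (\<lambda>t. h (p t) (u' t))"
    by (intro h.continuous_on contp u')
  have fint: "f integrable_on {c..d}" if "a \<le> c" "d \<le> b" for c d
    unfolding f_def
    by (intro integrable_add absint_prod contu that integrable_continuous_real
        continuous_on_subset[OF contpu']) (use that in auto)
  obtain K where K: "0 < K" "\<And>x y. norm (h x y) \<le> norm x * norm y * K"
    using h.pos_bounded by auto
  obtain C where C: "0 < C" "\<And>t. t \<in> {a..b} \<Longrightarrow> norm (u' t) \<le> C"
  proof -
    have "bounded (u' ` {a..b})"
      using u' by (intro compact_imp_bounded compact_continuous_image) auto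
    then show ?thesis using that unfolding bounded_pos by auto
  qed
  define m where "m = (\<lambda>t. integral {a..t} (\<lambda>r. norm (q r)))"
  have contm: "continuous_on {a..b} m"
    unfolding m_def by (rule indefinite_integral_continuous_1[OF nqint])
  define W where "W = (\<lambda>t. h (p t) (u t) - integral {a..t} f)"
  have key: "norm (W t - W s) \<le> (2 * K * C * \<bar>m t - m s\<bar>) * (t - s)"
    if st: "a \<le> s" "s \<le> t" "t \<le> b" for s t
  proof -
    have ints: "{s..t} \<subseteq> {a..b}" using st by auto
    have q_st: "(q has_integral (p r' - p r)) {r..r'}" if "s \<le> r" "r \<le> r'" "r' \<le> t" for r r'
    proof -
      have "q integrable_on {r..r'}"
        by (rule integrable_subinterval_real[OF qint]) (use that st in auto)
      moreover have "integral {a..r} q + integral {r..r'} q = integral {a..r'} q"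
        by (rule Henstock_Kurzweil_Integration.integral_combine)
          (use that st in \<open>auto intro: integrable_subinterval_real[OF qint]\<close>)
      then have "integral {r..r'} q = p r' - p r"
        using peq[of r] peq[of r'] that st by (simp add: algebra_simps)
      ultimately show ?thesis by (metis integrable_integral)
    qed
    have nq_int: "(\<lambda>r. norm (q r)) integrable_on {r..r'}" if "a \<le> r" "r' \<le> b" for r r'
      by (rule integrable_subinterval_real[OF nqint]) (use that in auto)
    have nq_st: "((\<lambda>r. norm (q r)) has_integral (m t - m s)) {s..t}"
    proof -
      have "integral {a..s} (\<lambda>r. norm (q r)) + integral {s..t} (\<lambda>r. norm (q r)) = m t"
        unfolding m_def by (rule Henstock_Kurzweil_Integration.integral_combine) (use st nq_int in auto)
      then show ?thesis
        using nq_int[of s t] st by (simp add: has_integral_iff m_def algebra_simps)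
    qed
    have du: "(u has_vector_derivative u' r) (at r within {s..t})" if "r \<in> {s..t}" for r
      using u[of r] that ints has_vector_derivative_within_subset by blast
    have u_st: "(u' has_integral (u t - u s)) {s..t}"
      by (rule fundamental_theorem_of_calculus[OF st(2) du])
    have f_st: "(f has_integral (integral {a..t} f - integral {a..s} f)) {s..t}"
    proof -
      have "integral {a..s} f + integral {s..t} f = integral {a..t} f"
        by (rule Henstock_Kurzweil_Integration.integral_combine) (use st fint in auto)
      then show ?thesis
        using fint[of s t] st by (simp add: has_integral_iff algebra_simps)
    qed
    have 1: "((\<lambda>r. h (q r) (u s)) has_integral h (p t - p s) (u s)) {s..t}"
      using has_integral_linear[OF q_st[of s t] h.bounded_linear_left[of "u s"]] st
      by (simp add: o_def)
    have 2: "((\<lambda>r. h (p t) (u' r)) has_integral h (p t) (u t - u s)) {s..t}"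
      using has_integral_linear[OF u_st h.bounded_linear_right[of "p t"]] by (simp add: o_def)
    have "((\<lambda>r. h (q r) (u s) + h (p t) (u' r) - f r) has_integral
        (h (p t - p s) (u s) + h (p t) (u t - u s) - (integral {a..t} f - integral {a..s} f))) {s..t}"
      by (intro has_integral_diff has_integral_add 1 2 f_st)
    moreover have "h (p t - p s) (u s) + h (p t) (u t - u s) - (integral {a..t} f - integral {a..s} f)
        = W t - W s"
      by (simp add: W_def h.diff_left h.diff_right)
    ultimately have W: "((\<lambda>r. h (q r) (u s) + h (p t) (u' r) - f r) has_integral (W t - W s)) {s..t}"
      by simp
    have bd: "norm (h (q r) (u s) + h (p t) (u' r) - f r)
        \<le> K * C * (t - s) * norm (q r) + K * C * (m t - m s)" if r: "r \<in> {s..t}" for r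
    proof -
      have ru: "norm (u s - u r) \<le> C * (t - s)"
      proof -
        have "(u' has_integral (u r - u s)) {s..r}"
        proof (rule fundamental_theorem_of_calculus)
          show "(u has_vector_derivative u' y) (at y within {s..r})" if "y \<in> {s..r}" for y
            by (rule has_vector_derivative_within_subset[OF du]) (use that r in auto)
        qed (use r in simp)
        then have "norm (u r - u s) \<le> C * measure lborel {s..r}"
          by (rule has_integral_bound_real[rotated 2, where S = "{}"])
            (use r ints C in \<open>auto simp: less_imp_le\<close>)
        then have "norm (u s - u r) \<le> C * (r - s)"
          using r by (simp add: norm_minus_commute)
        also have "\<dots> \<le> C * (t - s)" using r C(1) by (intro mult_left_mono) auto
        finally show ?thesis .
      qed
      have rp: "norm (p t - p r) \<le> m t - m s"
      proof -
        have "norm (p t - p r) = norm (integral {r..t} q)"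
          using q_st[of r t] r by (simp add: integral_unique)
        also have "\<dots> \<le> integral {r..t} (\<lambda>r. norm (q r))"
          by (rule integral_norm_bound_integral)
            (use q_st[of r t] nq_int[of r t] r st in auto)
        also have "\<dots> \<le> integral {s..t} (\<lambda>r. norm (q r))"
          by (rule integral_subset_le) (use nq_int r st in auto)
        also have "\<dots> = m t - m s" using nq_st by (rule integral_unique)
        finally show ?thesis .
      qed
      have "h (q r) (u s) + h (p t) (u' r) - f r = h (q r) (u s - u r) + h (p t - p r) (u' r)"
        by (simp add: f_def h.diff_left h.diff_right)
      also have "norm \<dots> \<le> norm (q r) * norm (u s - u r) * K + norm (p t - p r) * norm (u' r) * K"
        by (rule norm_triangle_le) (intro add_mono K)
      also have "\<dots> \<le> norm (q r) * (C * (t - s)) * K + (m t - m s) * C * K"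
        using ru rp C(2)[of r] r ints K(1) C(1) order_trans[OF norm_ge_zero rp]
        by (intro add_mono mult_right_mono mult_mono mult_left_mono) auto
      finally show ?thesis by (simp add: algebra_simps)
    qed
    have "((\<lambda>r. K * C * (t - s) * norm (q r) + K * C * (m t - m s)) has_integral
        (K * C * (t - s) * (m t - m s) + measure lborel {s..t} *\<^sub>R (K * C * (m t - m s)))) {s..t}"
      using has_integral_const_real[of "K * C * (m t - m s)" s t]
      by (intro has_integral_add has_integral_mult_right nq_st) simp
    then have dom: "((\<lambda>r. K * C * (t - s) * norm (q r) + K * C * (m t - m s)) has_integral
        (2 * K * C * (m t - m s) * (t - s))) {s..t}"
      using st by (simp add: algebra_simps)
    have "norm (W t - W s) \<le> 2 * K * C * (m t - m s) * (t - s)"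
      using integral_norm_bound_integral[OF has_integral_integrable[OF W]
          has_integral_integrable[OF dom] bd]
      by (simp add: integral_unique[OF W] integral_unique[OF dom])
    also have "\<dots> \<le> 2 * K * C * \<bar>m t - m s\<bar> * (t - s)"
      using st K(1) C(1) by (intro mult_right_mono mult_left_mono) auto
    finally show ?thesis .
  qed
  have key2: "norm (W t - W s) \<le> (2 * K * C * \<bar>m t - m s\<bar>) * \<bar>t - s\<bar>"
    if "s \<in> {a..b}" "t \<in> {a..b}" for s t
    using key[of s t] key[of t s] that
    by (cases "s \<le> t") (auto simp: norm_minus_commute abs_minus_commute)
  have "(W has_derivative (\<lambda>_. 0)) (at s within {a..b})" if s: "s \<in> {a..b}" for s
    unfolding has_derivative_within_alt
  proof (intro conjI allI impI)
    fix e :: real assume e: "0 < e"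
    have "0 < e / (2 * K * C)" using e K(1) C(1) by simp
    then obtain d where d: "0 < d"
      "\<And>t. t \<in> {a..b} \<Longrightarrow> dist t s < d \<Longrightarrow> dist (m t) (m s) < e / (2 * K * C)"
      using contm s unfolding continuous_on_iff by meson
    show "\<exists>d>0. \<forall>y\<in>{a..b}. norm (y - s) < d \<longrightarrow> norm (W y - W s - 0) \<le> e * norm (y - s)"
    proof (intro exI[of _ d] conjI ballI impI d(1))
      fix y assume y: "y \<in> {a..b}" "norm (y - s) < d"
      have "\<bar>m y - m s\<bar> \<le> e / (2 * K * C)"
        using d(2)[of y] y by (simp add: dist_norm)
      then have "2 * K * C * \<bar>m y - m s\<bar> \<le> e"
        using K(1) C(1) by (simp add: field_simps)
      then have "(2 * K * C * \<bar>m y - m s\<bar>) * \<bar>y - s\<bar> \<le> e * \<bar>y - s\<bar>"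
        by (rule mult_right_mono) simp
      then show "norm (W y - W s - 0) \<le> e * norm (y - s)"
        using key2[OF s y(1)] by simp
    qed
  qed simp
  then have "W b = W a"
    using has_derivative_zero_unique[of "{a..b}" W b a] ab by simp
  then have "integral {a..b} f = h (p b) (u b) - h (p a) (u a)"
    by (simp add: W_def algebra_simps)
  then show ?thesis
    using fint[of a b] by (simp add: has_integral_iff f_def)
qed

lemma W22_continuous_deriv:
  assumes "u \<in> W22 a b"
  shows "continuous_on {a..b} (deriv_on a b u)"
proof -
  let ?v = "deriv_on a b u"
  obtain w where w: "w absolutely_integrable_on {a..b}"
    and int: "\<And>t. t \<in> {a..b} \<Longrightarrow> (w has_integral (?v t - ?v a)) {a..t}"
    using assms unfolding W22_def by auto
  have "w integrable_on {a..b}"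
    using w absolutely_integrable_on_def by blast
  then have "continuous_on {a..b} (\<lambda>t. ?v a + integral {a..t} w)"
    by (intro continuous_intros indefinite_integral_continuous_1)
  then show ?thesis
    by (rule continuous_on_eq) (simp add: integral_unique[OF int])
qed

lemma continuous_on_cmul:
  assumes "continuous_on X A" and "continuous_on X f"
  shows "continuous_on X (\<lambda>t. A t *c f t)"
  unfolding matrix_vector_mult_def map_matrix_def
  by (simp, intro continuous_intros assms)

lemma sturm_pairing_eq_integral:
  assumes \<tau>: "0 < \<tau>" and u: "u \<in> W22 0 \<tau>"
    and Q: "continuous_on {0..\<tau>} Q" and R: "continuous_on {0..\<tau>} R"
    and p': "p' absolutely_integrable_on {0..\<tau>}"
    and p: "\<And>t. t \<in> {0..\<tau>} \<Longrightarrow>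
      (p' has_integral (momentum P Q \<tau> u t - momentum P Q \<tau> u 0)) {0..t}"
  shows "((\<lambda>t. cinner (- p' t + transpose (Q t) *c deriv_on 0 \<tau> u t + R t *c u t) (u t))
    has_integral sturm_pairing P Q R \<tau> u) {0..\<tau>}"
proof -
  interpret c: bounded_bilinear cinner by (rule bounded_bilinear_cinner)
  let ?v = "deriv_on 0 \<tau> u"
  let ?p = "momentum P Q \<tau> u"
  let ?g = "\<lambda>t. cinner (transpose (Q t) *c ?v t + R t *c u t) (u t)"
  have du: "(u has_vector_derivative ?v t) (at t within {0..\<tau>})" if "t \<in> {0..\<tau>}" for t
    using u that by (auto simp: W22_def vector_derivative_works)
  have contu: "continuous_on {0..\<tau>} u"
    using du has_vector_derivative_continuous continuous_on_eq_continuous_within by blast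
  note contv = W22_continuous_deriv[OF u]
  have ibp: "((\<lambda>t. cinner (p' t) (u t) + cinner (?p t) (?v t)) has_integral
      (cinner (?p \<tau>) (u \<tau>) - cinner (?p 0) (u 0))) {0..\<tau>}"
    by (rule has_integral_by_parts_ac[OF bounded_bilinear_cinner \<tau> du contv p' p])
  have contp: "continuous_on {0..\<tau>} ?p"
  proof -
    have "p' integrable_on {0..\<tau>}"
      using p' absolutely_integrable_on_def by blast
    then have "continuous_on {0..\<tau>} (\<lambda>t. ?p 0 + integral {0..t} p')"
      by (intro continuous_intros indefinite_integral_continuous_1)
    then show ?thesis
      by (rule continuous_on_eq) (simp add: integral_unique[OF p])
  qed
  have contQT: "continuous_on {0..\<tau>} (\<lambda>t. transpose (Q t))"
    unfolding transpose_def by (intro continuous_intros Q)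
  have "continuous_on {0..\<tau>} (\<lambda>t. cinner (?p t) (?v t) + ?g t)"
    by (intro continuous_on_add c.continuous_on contp contv contu continuous_on_cmul contQT R)
  then have "((\<lambda>t. cinner (?p t) (?v t) + ?g t) has_integral
      integral {0..\<tau>} (\<lambda>t. cinner (?p t) (?v t) + ?g t)) {0..\<tau>}"
    by (intro integrable_integral integrable_continuous_real)
  from has_integral_diff[OF this ibp] show ?thesis
    by (simp add: sturm_pairing_def c.add_left c.diff_left c.minus_left algebra_simps)
qed

end

theory Submission
  imports Defs
begin

text \<open>
  Write \<open>\<tau> = T/(2n)\<close>, \<open>q\<^sub>t(\<xi>) = \<langle>Q(t)\<xi>, \<xi>\<rangle>\<close> and \<open>\<phi>\<^sub>t(\<xi>, v) = \<langle>Pv, v\<rangle> + 2\<langle>Q\<xi>, v\<rangle> + \<langle>R\<xi>, \<xi>\<rangle>\<close>. On a Neumann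
  function the boundary terms of \<open>\<langle>\<A>u, u\<rangle>\<close> reduce to \<open>q\<close>, because \<open>u'\<close> vanishes at the end
  points; positivity of \<open>\<A>\<close> therefore says that
  \<open>q\<^sub>\<tau>(u(\<tau>)) - q\<^sub>0(u(0)) \<le> \<integral> \<phi>\<^sub>t(u, u') dt\<close> over \<open>[0, \<tau>]\<close>. Neither side depends on \<open>u'\<close> at
  single points, so by density the Neumann condition may be dropped: the inequality holds for
  every \<open>C\<^sup>1\<close> function (\<open>boundary_dominated_of_psd\<close>). It is this form of the hypothesis that
  can be moved around. The reflection \<open>t \<mapsto> 2\<tau> - t\<close> acts by \<open>N\<close>, changes the sign of \<open>q\<close> (\<open>Q\<close> is a
  derivative taken once in the velocity) and also exchanges the end points, so the inequality is
  preserved; the shift by \<open>2\<tau>\<close> acts by \<open>S\<close> and preserves it as well; and inequalities on adjacent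
  intervals add up. Hence it holds on \<open>[0, T]\<close> (\<open>boundary_dominated_dihedral\<close>), where \<open>q\<^sub>T = q\<^sub>0\<close>.

  Now let \<open>z = (y, \<xi>)\<close> solve the Hamiltonian system. Then \<open>y = P\<xi>' + Q\<xi>\<close> and \<open>\<langle>y, \<xi>\<rangle>' = \<phi>\<^sub>t(\<xi>, \<xi>')\<close>,
  so with \<open>\<beta>(y, \<xi>) = \<langle>y, \<xi>\<rangle> - q\<^sub>0(\<xi>)\<close> the inequality becomes \<open>\<beta>(Mz) \<ge> \<beta>(z)\<close> for the monodromy
  matrix \<open>M\<close> (\<open>lyapunov_form_le_monodromy\<close>): the quadratic form \<open>\<beta>\<close> is a weak Lyapunov function.

  Such a matrix is a limit of unstable ones. In the coordinates \<open>(y - Q\<^sub>s\<xi>, \<xi>)\<close>, with \<open>Q\<^sub>s\<close> the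
  symmetric part of \<open>Q(0)\<close>, the form \<open>\<beta>\<close> is the hyperbolic form \<open>\<langle>a, \<xi>\<rangle>\<close>, and the Lorentz boost
  with parameters \<open>cosh\<close>, \<open>sinh\<close> is a symplectic matrix, as close to the identity as desired,
  that strictly increases \<open>\<beta>\<close> off the origin (\<open>lyapunov_form_boost_gt\<close>). Composing it with \<open>M\<close> makes \<open>\<beta>\<close>
  a strict Lyapunov function. A linearly stable matrix has none: \<open>\<beta>\<close> would converge along an orbit,
  which is bounded and bounded away from \<open>0\<close>, and so would be constant along the orbit of a
  nonzero limit point (\<open>strict_lyapunov_imp_not_linearly_stable\<close>).
\<close>

section \<open>Real matrices\<close>

lemma neg_mat_mult_vec: "(- A) *v x = - (A *v (x::real^'n))" for A :: "real^'n^'m"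
  by (simp add: vec_eq_iff matrix_vector_mult_def sum_negf)

lemma inner_transpose_left: "(transpose A *v x) \<bullet> y = x \<bullet> (A *v y)" for A :: "real^'n^'m"
  by (simp add: dot_lmul_matrix)

lemma inner_transpose_right: "x \<bullet> (transpose A *v y) = (A *v x) \<bullet> y" for A :: "real^'n^'m"
  using inner_transpose_left[of A y x] by (simp add: inner_commute)

lemma symmetric_matrix_inner: "transpose Q = Q \<Longrightarrow> (Q *v x) \<bullet> y = x \<bullet> (Q *v y)" for Q :: "real^'n^'n"
  by (metis inner_transpose_left)

lemma matrix_inv_cancel:
  fixes A :: "real^'n^'n"
  assumes "invertible A"
  shows "A ** matrix_inv A = mat 1" "matrix_inv A ** A = mat 1"
  using someI_ex[OF assms[unfolded invertible_def]] by (simp_all add: matrix_inv_def)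

lemma mat_pow_Suc: "mat_pow A (Suc k) = A ** mat_pow A k"
  by (simp add: mat_pow_def)

lemma mat_pow_0: "mat_pow A 0 = mat 1"
  by (simp add: mat_pow_def)

lemma mat_pow_commute: "mat_pow A k ** A = A ** mat_pow A k"
  by (induction k) (simp_all add: mat_pow_0 mat_pow_Suc matrix_mul_assoc[symmetric])

lemma mat_pow_inverse:
  assumes "A ** A' = mat 1"
  shows "mat_pow A k ** mat_pow A' k = mat 1"
proof (induction k)
  case 0 show ?case by (simp add: mat_pow_0)
next
  case (Suc k)
  have "mat_pow A (Suc k) ** mat_pow A' (Suc k) = mat_pow A k ** (A ** A') ** mat_pow A' k"
    by (metis mat_pow_Suc mat_pow_commute matrix_mul_assoc)
  then show ?case using assms Suc by simp
qed

lemma matrix_mul_add_left: "(A + B) ** C = A ** C + B ** (C :: real^'k^'n)" for A :: "real^'n^'m"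
  by (simp add: matrix_matrix_mult_def vec_eq_iff sum.distrib algebra_simps)

lemma matrix_mul_scaleR_left: "(c *\<^sub>R A) ** C = c *\<^sub>R (A ** (C :: real^'k^'n))" for A :: "real^'n^'m"
  by (simp add: matrix_matrix_mult_def vec_eq_iff sum_distrib_left algebra_simps)

lemma op_norm_le_norm:
  fixes A :: "real^'n^'n"
  shows "op_norm A \<le> real CARD('n) * real CARD('n) * norm A"
  by (rule onorm_le_matrix_component)
    (metis Finite_Cartesian_Product.norm_nth_le order_trans real_norm_def)

lemma matrix_symmetric_of_inner:
  assumes "\<And>v w. (A *v v) \<bullet> w = (A *v w) \<bullet> (v::real^'n)"
  shows "transpose A = A"
proof -
  have "x \<bullet> (transpose A *v y) = x \<bullet> (A *v y)" for x y :: "real^'n"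
    unfolding inner_transpose_right assms[of x y] by (rule inner_commute)
  then show ?thesis by (metis matrix_eq vector_eq_ldot)
qed

lemma invertible_of_positive:
  fixes A :: "real^'n^'n"
  assumes "\<And>w. w \<noteq> 0 \<Longrightarrow> 0 < (A *v w) \<bullet> w"
  shows "invertible A"
proof -
  have "w = 0" if "A *v w = 0" for w using assms[of w] that by force
  then show ?thesis using invertible_left_inverse matrix_left_invertible_ker by blast
qed

lemma continuous_on_mat_vec:
  fixes A :: "'a::topological_space \<Rightarrow> real^'n^'m"
  assumes "continuous_on X A" "continuous_on X f"
  shows "continuous_on X (\<lambda>t. A t *v f t)"
  unfolding matrix_vector_mult_def by (intro continuous_intros assms)

text \<open>
  By Cramer's rule the solution is a quotient of polynomials in the data.
\<close>

lemma continuous_on_solve: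
  fixes A :: "'a::topological_space \<Rightarrow> real^'n^'n"
  assumes A: "continuous_on X A" and b: "continuous_on X b"
    and inv: "\<And>t. t \<in> X \<Longrightarrow> invertible (A t)" and x: "\<And>t. t \<in> X \<Longrightarrow> A t *v x t = b t"
  shows "continuous_on X x"
proof -
  have det: "continuous_on X (\<lambda>t. det (M t))" if "\<And>i j. continuous_on X (\<lambda>t. M t $ i $ j)" for M :: "'a \<Rightarrow> real^'n^'n"
    unfolding det_def by (intro continuous_intros that)
  have nz: "det (A t) \<noteq> 0" if "t \<in> X" for t
    using inv[OF that] invertible_det_nz by blast
  have "continuous_on X (\<lambda>t. \<chi> k. det (\<chi> i j. if j = k then b t $ i else A t $ i $ j) / det (A t))"
  proof (intro continuous_on_vec_lambda continuous_on_divide det ballI)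
    fix k i j
    show "continuous_on X (\<lambda>t. (\<chi> i j. if j = k then b t $ i else A t $ i $ j) $ i $ j)"
      by (cases "j = k") (auto intro!: continuous_intros A b)
  qed (use nz in \<open>auto intro!: continuous_intros A\<close>)
  then show ?thesis
  proof (rule continuous_on_eq)
    show "(\<chi> k. det (\<chi> i j. if j = k then b t $ i else A t $ i $ j) / det (A t)) = x t" if "t \<in> X" for t
      using cramer[OF nz[OF that], of "x t" "b t"] x[OF that] by simp
  qed
qed

lemma sum_axis: "(\<Sum>i\<in>UNIV. v $ i *\<^sub>R axis i 1) = (v :: real^'m)"
  by (simp add: vec_eq_iff axis_def if_distrib sum.delta cong: if_cong)

text \<open>
  Identifies the blocks of a Hessian, which are given by their entries, with restrictions of the
  second derivative to the position and velocity directions \<open>i\<close> and \<open>j\<close>.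
\<close>

lemma matrix_of_bilinear_inner:
  fixes h :: "'a::real_normed_vector \<Rightarrow>\<^sub>L 'a \<Rightarrow>\<^sub>L real"
  assumes "linear i" "linear j"
  shows "((\<chi> k l. h (i (axis k 1)) (j (axis l 1))) *v (v::real^'m)) \<bullet> w = h (i w) (j (v::real^'m))"
proof -
  have "h (i w) (j v) = h (i (\<Sum>k\<in>UNIV. w $ k *\<^sub>R axis k 1)) (j (\<Sum>l\<in>UNIV. v $ l *\<^sub>R axis l 1))"
    by (simp only: sum_axis)
  also have "\<dots> = (\<Sum>k\<in>UNIV. w $ k * (\<Sum>l\<in>UNIV. v $ l * h (i (axis k 1)) (j (axis l 1))))"
    by (simp add: linear_sum[OF assms(1)] linear_sum[OF assms(2)] linear_cmul[OF assms(1)] linear_cmul[OF assms(2)]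
        blinfun.bilinear_simps blinfun.sum_left blinfun.sum_right)
      (simp only: sum_distrib_left, subst sum.swap, simp only: mult.left_commute)
  also have "\<dots> = (\<Sum>k\<in>UNIV. \<Sum>l\<in>UNIV. w $ k * (v $ l * h (i (axis k 1)) (j (axis l 1))))"
    by (simp only: sum_distrib_left)
  finally have 1: "h (i w) (j v) = (\<Sum>k\<in>UNIV. \<Sum>l\<in>UNIV. w $ k * (v $ l * h (i (axis k 1)) (j (axis l 1))))" .
  show ?thesis
    unfolding 1 inner_vec_def matrix_vector_mult_def
    by (simp only: inner_real_def vec_lambda_beta sum_distrib_right) (simp only: mult.commute mult.left_commute)
qed

section \<open>Symplectic matrices with a Lyapunov function\<close>

text \<open>
  If all powers of \<open>M\<close> are bounded, an orbit \<open>s\<close> of \<open>M\<close> that starts at a nonzero point stays in a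
  ball, and the bound on the negative powers keeps it away from \<open>0\<close>. The values of \<open>\<beta>\<close> increase
  along it to a limit, which is then the value of \<open>\<beta>\<close> both at a limit point \<open>w\<close> of \<open>s\<close> and at \<open>M w\<close>.
\<close>

lemma strict_lyapunov_imp_not_linearly_stable:
  fixes M :: "real^'k^'k" and \<beta> :: "real^'k \<Rightarrow> real"
  assumes inv: "invertible M" and cont: "continuous_on UNIV \<beta>"
    and less: "\<And>z. z \<noteq> 0 \<Longrightarrow> \<beta> z < \<beta> (M *v z)"
  shows "\<not> linearly_stable M"
proof
  assume "linearly_stable M"
  then obtain C where C: "\<And>k. op_norm (mat_zpow M k) \<le> C"
    unfolding linearly_stable_def bdd_above_def by auto
  \<comment> \<open>The starting point may be any unit vector.\<close>
  define s where "s k = mat_pow M k *v axis undefined 1" for k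
  let ?e = "axis undefined 1 :: real^'k"
  have bd: "norm (mat_zpow M k *v v) \<le> C * norm v" for k v
    using order_trans[OF onorm[OF matrix_vector_mul_bounded_linear] mult_right_mono[OF C norm_ge_zero]] .
  have up: "norm (s k) \<le> C" for k
    using bd[of "int k" ?e] by (simp add: mat_zpow_def s_def)
  have low: "1 \<le> C * norm (s k)" for k
  proof -
    have "mat_zpow M (- int k) = mat_pow (matrix_inv M) k"
      by (simp add: mat_zpow_def mat_pow_0)
    moreover have "mat_pow (matrix_inv M) k *v s k = ?e"
      by (simp add: s_def matrix_vector_mul_assoc mat_pow_inverse[OF matrix_inv_cancel(2)[OF inv]])
    ultimately show ?thesis using bd[of "- int k" "s k"] by simp
  qed
  have s_Suc: "s (Suc k) = M *v s k" for k
    by (simp add: s_def mat_pow_Suc matrix_vector_mul_assoc)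
  have s_nz: "s k \<noteq> 0" for k using low[of k] by auto
  have in_ball: "s k \<in> cball 0 C" for k using up by simp
  obtain w r where w: "strict_mono (r :: nat \<Rightarrow> nat)" "(s \<circ> r) \<longlonglongrightarrow> w"
    using compact_cball[of "0::real^'k" C] in_ball unfolding compact_def by metis
  have inc: "incseq (\<lambda>k. \<beta> (s k))"
    by (rule incseq_SucI) (simp add: s_Suc less s_nz less_imp_le)
  have "bounded (\<beta> ` cball 0 C)"
    by (intro compact_imp_bounded compact_continuous_image continuous_on_subset[OF cont]) auto
  then obtain K where K: "\<And>x. x \<in> cball 0 C \<Longrightarrow> \<bar>\<beta> x\<bar> \<le> K"
    unfolding bounded_iff by (metis imageI real_norm_def)
  have "\<beta> (s k) \<le> K" for k using K[OF in_ball[of k]] by simp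
  then obtain l where l: "(\<lambda>k. \<beta> (s k)) \<longlonglongrightarrow> l"
    using incseq_convergent[OF inc] by metis
  have "(\<lambda>k. \<beta> (s (r k))) \<longlonglongrightarrow> l"
    using LIMSEQ_subseq_LIMSEQ[OF l w(1)] by (simp add: o_def)
  moreover have "(\<lambda>k. \<beta> (s (r k))) \<longlonglongrightarrow> \<beta> w"
    using continuous_on_tendsto_compose[OF cont w(2)] by simp
  ultimately have 1: "l = \<beta> w" using LIMSEQ_unique by blast
  \<comment> \<open>Shifting the subsequence by one step evaluates the same limit at \<open>M w\<close>.\<close>
  have "strict_mono (\<lambda>k. Suc (r k))" using w(1) by (simp add: strict_mono_def)
  from LIMSEQ_subseq_LIMSEQ[OF l this] have "(\<lambda>k. \<beta> (M *v s (r k))) \<longlonglongrightarrow> l"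
    by (simp add: o_def s_Suc)
  moreover have "(\<lambda>k. M *v s (r k)) \<longlonglongrightarrow> M *v w"
    using bounded_linear.tendsto[OF matrix_vector_mul_bounded_linear w(2), of M] by (simp add: o_def)
  then have "(\<lambda>k. \<beta> (M *v s (r k))) \<longlonglongrightarrow> \<beta> (M *v w)"
    using continuous_on_tendsto_compose[OF cont] by auto
  ultimately have "l = \<beta> (M *v w)" using LIMSEQ_unique by blast
  with 1 less[of w] have "w = 0" by auto
  moreover have "1 \<le> C * norm w"
  proof (rule LIMSEQ_le_const)
    show "(\<lambda>k. C * norm (s (r k))) \<longlonglongrightarrow> C * norm w"
      using w(2) by (auto intro!: tendsto_intros simp: o_def)
  qed (use low in auto)
  ultimately show False by simp
qed

text \<open>
  The momentum part of a phase space vector; the other half is the position.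
\<close>

definition fst_half :: "real^('m::finite + 'm) \<Rightarrow> real^'m" where
  "fst_half z = (\<chi> i. z $ Inl i)"

definition snd_half :: "real^('m::finite + 'm) \<Rightarrow> real^'m" where
  "snd_half z = (\<chi> i. z $ Inr i)"

lemma half_eqI: "fst_half z = fst_half w \<Longrightarrow> snd_half z = snd_half w \<Longrightarrow> z = w"
  unfolding fst_half_def snd_half_def vec_eq_iff by (metis sum.exhaust vec_lambda_beta)

lemma bounded_linear_fst_half: "bounded_linear fst_half"
  by (auto simp: fst_half_def vec_eq_iff linear_iff intro!: linear_conv_bounded_linear[THEN iffD1])

lemma bounded_linear_snd_half: "bounded_linear snd_half"
  by (auto simp: snd_half_def vec_eq_iff linear_iff intro!: linear_conv_bounded_linear[THEN iffD1])

lemma sum_UNIV_Plus: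
  fixes f :: "'a::finite + 'b::finite \<Rightarrow> 'c::comm_monoid_add"
  shows "sum f UNIV = (\<Sum>i\<in>UNIV. f (Inl i)) + (\<Sum>i\<in>UNIV. f (Inr i))"
  unfolding UNIV_Plus_UNIV[symmetric] by (subst sum.Plus) (auto simp: o_def)

lemma inner_halves: "z \<bullet> w = fst_half z \<bullet> fst_half w + snd_half z \<bullet> snd_half w"
  by (simp add: inner_vec_def fst_half_def snd_half_def sum_UNIV_Plus)

lemma halves_block_mat_mult:
  "fst_half (block_mat A B C D *v z) = A *v fst_half z + B *v snd_half z"
  "snd_half (block_mat A B C D *v z) = C *v fst_half z + D *v snd_half z"
  by (simp_all add: block_mat_def fst_half_def snd_half_def matrix_vector_mult_def
      sum_UNIV_Plus vec_eq_iff)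

definition symp_form :: "real^('m::finite + 'm) \<Rightarrow> real^('m + 'm) \<Rightarrow> real" where
  "symp_form z w = fst_half z \<bullet> snd_half w - snd_half z \<bullet> fst_half w"

lemma inner_J_mat: "z \<bullet> (J_mat *v w) = - symp_form z w"
  by (simp add: inner_halves J_mat_def halves_block_mat_mult symp_form_def neg_mat_mult_vec)

text \<open>
  Working with the form avoids all block matrix multiplications.
\<close>

lemma symplectic_iff_symp_form:
  "symplectic M \<longleftrightarrow> (\<forall>z w. symp_form (M *v z) (M *v w) = symp_form z w)"
proof -
  have eq: "(transpose M ** J_mat ** M = J_mat) \<longleftrightarrow>
      (\<forall>z w. z \<bullet> ((transpose M ** J_mat ** M) *v w) = z \<bullet> (J_mat *v w))"
    by (metis matrix_eq vector_eq_ldot)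
  have "z \<bullet> ((transpose M ** J_mat ** M) *v w) = - symp_form (M *v z) (M *v w)" for z w
  proof -
    have "(transpose M ** J_mat ** M) *v w = transpose M *v (J_mat *v (M *v w))"
      by (simp only: matrix_vector_mul_assoc matrix_mul_assoc)
    then show ?thesis by (simp only: inner_transpose_right inner_J_mat)
  qed
  then show ?thesis
    unfolding symplectic_def eq by (simp add: inner_J_mat)
qed

lemma symplectic_imp_invertible:
  assumes "symplectic M"
  shows "invertible M"
proof -
  have "z = 0" if "M *v z = 0" for z
  proof -
    have "symp_form z w = 0" for w
      using assms that unfolding symplectic_iff_symp_form
      by (metis (no_types) add.left_neutral bounded_linear_fst_half bounded_linear_snd_half diff_zero inner_zero_left
          linear_simps(3) symp_form_def)
    then have "z \<bullet> (J_mat *v w) = 0" for w by (simp add: inner_J_mat)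
    then have "fst_half z \<bullet> - snd_half w + snd_half z \<bullet> fst_half w = 0" for w
      unfolding inner_J_mat symp_form_def by (simp add: inner_halves algebra_simps)
    \<comment> \<open>Since \<open>J\<^sup>2 = -I\<close>, testing with \<open>J z\<close> gives the squared norm of \<open>z\<close>.\<close>
    from this[of "J_mat *v z"] have "fst_half z \<bullet> fst_half z + snd_half z \<bullet> snd_half z = 0"
      by (simp add: J_mat_def halves_block_mat_mult neg_mat_mult_vec)
    then show "z = 0" unfolding inner_halves[symmetric] by simp
  qed
  then show ?thesis
    using invertible_left_inverse matrix_left_invertible_ker by blast
qed

text \<open>
  In the coordinates \<open>(a, \<xi>) = (y - Q \<xi>, \<xi>)\<close> this is the Lorentz boost
  \<open>(a, \<xi>) \<mapsto> (c a + s \<xi>, c \<xi> + s a)\<close>, as the next lemma states.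
\<close>

definition boost :: "real^'m^'m \<Rightarrow> real \<Rightarrow> real \<Rightarrow> real^('m::finite + 'm)^('m + 'm)" where
  "boost Q c s = block_mat (c *\<^sub>R mat 1 + s *\<^sub>R Q) (s *\<^sub>R (mat 1 - Q ** Q))
     (s *\<^sub>R mat 1) (c *\<^sub>R mat 1 - s *\<^sub>R Q)"

lemma boost_mult:
  fixes Q :: "real^'m^'m" and z :: "real^('m::finite + 'm)"
  defines "a \<equiv> fst_half z - Q *v snd_half z"
  shows "snd_half (boost Q c s *v z) = c *\<^sub>R snd_half z + s *\<^sub>R a"
    and "fst_half (boost Q c s *v z) - Q *v snd_half (boost Q c s *v z) = c *\<^sub>R a + s *\<^sub>R snd_half z"
  by (simp_all add: boost_def halves_block_mat_mult a_def matrix_vector_mult_add_rdistrib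
      matrix_vector_mult_diff_rdistrib scaleR_matrix_vector_assoc[symmetric] matrix_vector_mul_assoc[symmetric]
      matrix_vector_right_distrib matrix_vector_mult_diff_distrib matrix_vector_mult_scaleR algebra_simps)

text \<open>
  For symmetric \<open>Q\<close> the shear \<open>(y, \<xi>) \<mapsto> (y - Q \<xi>, \<xi>)\<close> is symplectic, so the boost may be checked
  to be symplectic in the sheared coordinates.
\<close>

lemma symp_form_shear:
  assumes "transpose Q = Q"
  shows "symp_form z w = (fst_half z - Q *v snd_half z) \<bullet> snd_half w - snd_half z \<bullet> (fst_half w - Q *v snd_half w)"
  by (simp add: symp_form_def inner_diff_left inner_diff_right symmetric_matrix_inner[OF assms])

lemma symplectic_boost:
  assumes Q: "transpose Q = Q" and cs: "c\<^sup>2 - s\<^sup>2 = 1"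
  shows "symplectic (boost Q c s)"
  unfolding symplectic_iff_symp_form
proof (intro allI)
  fix z w
  let ?a = "fst_half z - Q *v snd_half z" and ?b = "fst_half w - Q *v snd_half w"
  define x y where "x = snd_half z" and "y = snd_half w"
  have "symp_form (boost Q c s *v z) (boost Q c s *v w)
      = (c *\<^sub>R ?a + s *\<^sub>R x) \<bullet> (c *\<^sub>R y + s *\<^sub>R ?b) - (c *\<^sub>R x + s *\<^sub>R ?a) \<bullet> (c *\<^sub>R ?b + s *\<^sub>R y)"
    unfolding symp_form_shear[OF Q] x_def y_def boost_mult(2) by (simp only: boost_mult(1))
  also have "(c *\<^sub>R a + s *\<^sub>R x) \<bullet> (c *\<^sub>R y + s *\<^sub>R b) - (c *\<^sub>R x + s *\<^sub>R a) \<bullet> (c *\<^sub>R b + s *\<^sub>R y)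
      = (c\<^sup>2 - s\<^sup>2) * (a \<bullet> y - x \<bullet> b)" for a b
    by (simp add: inner_add_left inner_add_right power2_eq_square algebra_simps)
  finally have "symp_form (boost Q c s *v z) (boost Q c s *v w)
      = (c\<^sup>2 - s\<^sup>2) * (?a \<bullet> snd_half w - snd_half z \<bullet> ?b)"
    unfolding x_def y_def .
  then show "symp_form (boost Q c s *v z) (boost Q c s *v w) = symp_form z w"
    unfolding symp_form_shear[OF Q] cs by simp
qed

text \<open>
  Defined for arbitrary \<open>Q\<close>, because the mixed block \<open>L_vx\<close> of the Hessian need not be symmetric.
\<close>

definition lyapunov_form :: "real^'m^'m \<Rightarrow> real^('m::finite + 'm) \<Rightarrow> real" where
  "lyapunov_form Q z = fst_half z \<bullet> snd_half z - (Q *v snd_half z) \<bullet> snd_half z"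

lemma lyapunov_form_eq: "lyapunov_form Q z = (fst_half z - Q *v snd_half z) \<bullet> snd_half z"
  by (simp add: lyapunov_form_def inner_diff_left)

text \<open>
  In the coordinates \<open>(a, b) = (y - Q \<xi>, \<xi>)\<close> the form is \<open>\<langle>a, b\<rangle>\<close>, and the boost changes it to
  \<open>(c\<^sup>2 + s\<^sup>2)\<langle>a, b\<rangle> + c s (|a|\<^sup>2 + |b|\<^sup>2)\<close>. The gain \<open>2s\<^sup>2\<langle>a, b\<rangle> + c s (|a|\<^sup>2 + |b|\<^sup>2)\<close> is at least
  \<open>s (c - s)(|a|\<^sup>2 + |b|\<^sup>2)\<close>.
\<close>

lemma lyapunov_form_boost_gt:
  assumes s: "0 < s" "s < c" and cs: "c\<^sup>2 - s\<^sup>2 = 1" and z: "z \<noteq> 0"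
  shows "lyapunov_form Q z < lyapunov_form Q (boost Q c s *v z)"
proof -
  define a b where "a = fst_half z - Q *v snd_half z" and "b = snd_half z"
  have "a \<noteq> 0 \<or> b \<noteq> 0"
    using z half_eqI[of z 0] linear_0[OF bounded_linear.linear[OF bounded_linear_fst_half]]
      linear_0[OF bounded_linear.linear[OF bounded_linear_snd_half]]
    unfolding a_def b_def by auto
  then have pos: "0 < norm a ^ 2 + norm b ^ 2"
    by (metis add_nonneg_pos add_pos_nonneg zero_le_power2 zero_less_norm_iff zero_less_power)
  have "lyapunov_form Q (boost Q c s *v z) = (c *\<^sub>R a + s *\<^sub>R b) \<bullet> (c *\<^sub>R b + s *\<^sub>R a)"
    unfolding lyapunov_form_eq boost_mult(2) a_def b_def by (simp only: boost_mult(1))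
  also have "\<dots> = (c\<^sup>2 - s\<^sup>2) * (a \<bullet> b) + 2 * s\<^sup>2 * (a \<bullet> b) + c * s * (norm a ^ 2 + norm b ^ 2)"
    by (simp add: inner_add_left inner_add_right dot_square_norm[symmetric] power2_eq_square[of c] power2_eq_square[of s] inner_commute algebra_simps)
  also have "\<dots> > a \<bullet> b"
  proof -
    have "0 \<le> (norm a - norm b)^2" by simp
    then have "2 * (norm a * norm b) \<le> norm a ^ 2 + norm b ^ 2"
      by (simp add: power2_diff)
    with norm_cauchy_schwarz[of "-a" b] have "- (2 * (a \<bullet> b)) \<le> norm a ^ 2 + norm b ^ 2"
      by simp
    then have "s\<^sup>2 * - (2 * (a \<bullet> b)) \<le> s\<^sup>2 * (norm a ^ 2 + norm b ^ 2)"
      by (rule mult_left_mono) simp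
    also have "\<dots> < c * s * (norm a ^ 2 + norm b ^ 2)"
      using s pos by (intro mult_strict_right_mono) (auto simp: power2_eq_square)
    finally show ?thesis unfolding cs by (simp add: algebra_simps)
  qed
  finally show ?thesis by (simp add: lyapunov_form_eq a_def b_def)
qed

lemma continuous_on_lyapunov_form: "continuous_on UNIV (lyapunov_form Q)"
  unfolding lyapunov_form_def
  by (intro continuous_intros bounded_linear.continuous_on[OF bounded_linear_fst_half]
      bounded_linear.continuous_on[OF bounded_linear_snd_half]
      bounded_linear.continuous_on[OF matrix_vector_mul_bounded_linear])

text \<open>
  The boost with parameters \<open>c = sqrt (1 + s\<^sup>2)\<close> and small \<open>s > 0\<close> turns the weak Lyapunov
  inequality into a strict one while moving \<open>M\<close> by less than any prescribed amount.
\<close>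

lemma lyapunov_imp_not_strongly_stable:
  assumes M: "symplectic M" and le: "\<And>z. lyapunov_form Q z \<le> lyapunov_form Q (M *v z)"
  shows "\<not> strongly_stable_mat M"
proof
  assume "strongly_stable_mat M"
  then obtain \<epsilon> where e: "0 < \<epsilon>"
    and stable: "\<And>M'. symplectic M' \<Longrightarrow> op_norm (M' - M) < \<epsilon> \<Longrightarrow> linearly_stable M'"
    unfolding strongly_stable_mat_def by blast
  \<comment> \<open>Only a symmetric shear is symplectic.\<close>
  define Qs where "Qs = (1/2) *\<^sub>R (Q + transpose Q)"
  have sym: "transpose Qs = Qs"
    by (simp add: Qs_def transpose_def vec_eq_iff)
  have lyapunov_form_Qs: "lyapunov_form Qs = lyapunov_form Q"
  proof
    fix z :: "real^('a + 'a)"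
    have "(transpose Q *v snd_half z) \<bullet> snd_half z = (Q *v snd_half z) \<bullet> snd_half z"
      unfolding inner_transpose_left by (rule inner_commute)
    then show "lyapunov_form Qs z = lyapunov_form Q z"
      by (simp add: lyapunov_form_def Qs_def scaleR_matrix_vector_assoc[symmetric] matrix_vector_mult_add_rdistrib inner_add_left
          del: transpose_matrix_vector)
  qed
  \<comment> \<open>The boost is \<open>c I + s F\<close> with \<open>F = boost Qs 0 1\<close>, which makes its distance to \<open>I\<close> explicit.\<close>
  define N where "N = boost Qs 0 1 ** M"
  define c where "c s = sqrt (1 + s\<^sup>2)" for s
  have boost: "boost Qs (c s) s ** M - M = (c s - 1) *\<^sub>R M + s *\<^sub>R N" for s
  proof -
    have "boost Qs (c s) s = c s *\<^sub>R mat 1 + s *\<^sub>R boost Qs 0 1"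
      by (auto simp: boost_def block_mat_def vec_eq_iff mat_def split: sum.splits)
    then show ?thesis
      by (simp add: N_def matrix_mul_add_left matrix_mul_scaleR_left algebra_simps)
  qed
  define K where "K = real CARD('a + 'a) * real CARD('a + 'a)"
  have "((\<lambda>s. K * norm ((c s - 1) *\<^sub>R M + s *\<^sub>R N)) \<longlongrightarrow> K * norm ((c 0 - 1) *\<^sub>R M + 0 *\<^sub>R N)) (at_right 0)"
    unfolding c_def by (intro tendsto_intros)
  then have "\<forall>\<^sub>F s in at_right 0. K * norm ((c s - 1) *\<^sub>R M + s *\<^sub>R N) < \<epsilon>"
    by (rule order_tendstoD) (simp add: c_def e)
  moreover have "\<forall>\<^sub>F s in at_right (0::real). 0 < s" by (simp add: eventually_at_right_less)
  ultimately obtain s where s: "0 < s" "K * norm ((c s - 1) *\<^sub>R M + s *\<^sub>R N) < \<epsilon>"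
    using eventually_happens[OF eventually_conj] trivial_limit_at_right_real by blast
  let ?E = "boost Qs (c s) s"
  have cs: "(c s)\<^sup>2 - s\<^sup>2 = 1" by (simp add: c_def)
  have sc: "s < c s" unfolding c_def by (rule real_less_rsqrt) simp
  have sE: "symplectic (?E ** M)"
    using symplectic_boost[OF sym cs] M
    unfolding symplectic_iff_symp_form by (simp add: matrix_vector_mul_assoc[symmetric])
  have "op_norm (?E ** M - M) \<le> K * norm (?E ** M - M)"
    unfolding K_def by (rule op_norm_le_norm)
  with s have "op_norm (?E ** M - M) < \<epsilon>" unfolding boost by simp
  with sE have "linearly_stable (?E ** M)" by (rule stable)
  moreover have "\<not> linearly_stable (?E ** M)"
  proof (rule strict_lyapunov_imp_not_linearly_stable)
    show "invertible (?E ** M)" by (rule symplectic_imp_invertible[OF sE])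
    show "continuous_on UNIV (lyapunov_form Q)" by (rule continuous_on_lyapunov_form)
    fix z :: "real^('a + 'a)" assume z: "z \<noteq> 0"
    have "M *v z \<noteq> 0"
      using z matrix_left_invertible_ker[of M] symplectic_imp_invertible[OF M] invertible_left_inverse by blast
    from lyapunov_form_boost_gt[OF s(1) sc cs this, of Qs] le[of z]
    show "lyapunov_form Q z < lyapunov_form Q (?E ** M *v z)"
      unfolding lyapunov_form_Qs by (simp add: matrix_vector_mul_assoc)
  qed
  ultimately show False by contradiction
qed

section \<open>Second derivatives\<close>

text \<open>
  The mean value theorem, once in the direction \<open>a\<close> and once in the direction \<open>b\<close>. The left-hand
  side is symmetric in \<open>a\<close> and \<open>b\<close>, which is how the symmetry of the second derivative arises.
\<close>

lemma second_difference_mvt: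
  fixes f :: "'a::real_normed_vector \<Rightarrow> real"
  assumes d1: "\<And>z. (f has_derivative blinfun_apply (f' z)) (at z)"
    and d2: "\<And>z. (f' has_derivative blinfun_apply (f'' z)) (at z)"
    and s: "0 < s"
  obtains p q where "0 < p" "p < s" "0 < q" "q < s"
    "f (z + s *\<^sub>R a + s *\<^sub>R b) - f (z + s *\<^sub>R a) - f (z + s *\<^sub>R b) + f z
      = s * s * f'' (z + p *\<^sub>R a + q *\<^sub>R b) b a"
proof -
  note [derivative_intros] = has_derivative_compose[OF _ d1]
  let ?h = "\<lambda>r. f (z + r *\<^sub>R a + s *\<^sub>R b) - f (z + r *\<^sub>R a)"
  have dh: "(?h has_derivative
      (\<lambda>x. x * (f' (z + r *\<^sub>R a + s *\<^sub>R b) a - f' (z + r *\<^sub>R a) a))) (at r)" for r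
    by (auto intro!: derivative_eq_intros
        simp: blinfun.bilinear_simps algebra_simps)
  obtain p where p: "p \<in> {0<..<s}"
    "?h s - ?h 0 = s * (f' (z + p *\<^sub>R a + s *\<^sub>R b) a - f' (z + p *\<^sub>R a) a)"
    using mvt_simple[OF s, of ?h, OF has_derivative_at_withinI[OF dh]] by auto
  let ?k = "\<lambda>r. f' (z + p *\<^sub>R a + r *\<^sub>R b) a"
  have dk: "(?k has_derivative (\<lambda>x. x * f'' (z + p *\<^sub>R a + r *\<^sub>R b) b a)) (at r)" for r
  proof -
    have "((\<lambda>r. z + p *\<^sub>R a + r *\<^sub>R b) has_derivative (\<lambda>x. x *\<^sub>R b)) (at r)"
      by (auto intro!: derivative_eq_intros)
    from has_derivative_compose[OF this d2]
    have "((\<lambda>r. f' (z + p *\<^sub>R a + r *\<^sub>R b)) has_derivative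
        (\<lambda>x. f'' (z + p *\<^sub>R a + r *\<^sub>R b) (x *\<^sub>R b))) (at r)" .
    from bounded_linear.has_derivative[OF blinfun.bounded_linear_left this, of a]
    show ?thesis by (simp add: blinfun.bilinear_simps)
  qed
  obtain q where q: "q \<in> {0<..<s}" "?k s - ?k 0 = s * f'' (z + p *\<^sub>R a + q *\<^sub>R b) b a"
    using mvt_simple[OF s, of ?k, OF has_derivative_at_withinI[OF dk]] by auto
  have "f (z + s *\<^sub>R a + s *\<^sub>R b) - f (z + s *\<^sub>R a) - f (z + s *\<^sub>R b) + f z
      = s * s * f'' (z + p *\<^sub>R a + q *\<^sub>R b) b a"
    using p(2) q(2) by simp
  then show ?thesis using that p(1) q(1) by auto
qed

text \<open>
  Schwarz's theorem: by the previous lemma, arbitrarily close to \<open>z\<close> there are two points at which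
  the two mixed derivatives agree.
\<close>

lemma second_derivative_symmetric:
  fixes f :: "'a::real_normed_vector \<Rightarrow> real"
  assumes d1: "\<And>z. (f has_derivative blinfun_apply (f' z)) (at z)"
    and d2: "\<And>z. (f' has_derivative blinfun_apply (f'' z)) (at z)"
    and c: "continuous_on UNIV f''"
  shows "f'' z a b = f'' z b a"
proof -
  define s where "s k = 1 / real (Suc k)" for k
  have s: "0 < s k" for k by (simp add: s_def)
  have s0: "s \<longlonglongrightarrow> 0" unfolding s_def using LIMSEQ_Suc[OF lim_1_over_n] by simp
  have "\<exists>p q p' q'. 0 < p \<and> p < s k \<and> 0 < q \<and> q < s k \<and> 0 < p' \<and> p' < s k \<and> 0 < q' \<and> q' < s k
      \<and> f'' (z + p *\<^sub>R a + q *\<^sub>R b) b a = f'' (z + p' *\<^sub>R a + q' *\<^sub>R b) a b" for k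
  proof -
    obtain p q where 1: "0 < p" "p < s k" "0 < q" "q < s k"
      "f (z + s k *\<^sub>R a + s k *\<^sub>R b) - f (z + s k *\<^sub>R a) - f (z + s k *\<^sub>R b) + f z
        = s k * s k * f'' (z + p *\<^sub>R a + q *\<^sub>R b) b a"
      using second_difference_mvt[OF d1 d2 s] by metis
    obtain p' q' where 2: "0 < p'" "p' < s k" "0 < q'" "q' < s k"
      "f (z + s k *\<^sub>R b + s k *\<^sub>R a) - f (z + s k *\<^sub>R b) - f (z + s k *\<^sub>R a) + f z
        = s k * s k * f'' (z + p' *\<^sub>R b + q' *\<^sub>R a) a b"
      using second_difference_mvt[OF d1 d2 s] by metis
    have "f'' (z + p *\<^sub>R a + q *\<^sub>R b) b a = f'' (z + q' *\<^sub>R a + p' *\<^sub>R b) a b"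
      using 1(5) 2(5) s[of k] by (simp add: algebra_simps)
    then show ?thesis using 1 2 by blast
  qed
  then obtain p q p' q' where
    pq: "\<And>k. 0 < p k \<and> p k < s k \<and> 0 < q k \<and> q k < s k"
      "\<And>k. 0 < p' k \<and> p' k < s k \<and> 0 < q' k \<and> q' k < s k"
    and eq: "\<And>k. f'' (z + p k *\<^sub>R a + q k *\<^sub>R b) b a = f'' (z + p' k *\<^sub>R a + q' k *\<^sub>R b) a b"
    by metis
  have sq: "r \<longlonglongrightarrow> 0" if "\<And>k. 0 < r k \<and> r k < s k" for r :: "nat \<Rightarrow> real"
    by (rule tendsto_sandwich[OF _ _ tendsto_const s0]) (use that in \<open>auto intro!: always_eventually simp: less_imp_le\<close>)
  have lim: "(\<lambda>k. f'' (z + p k *\<^sub>R a + q k *\<^sub>R b) c d) \<longlonglongrightarrow> f'' z c d"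
    if "p \<longlonglongrightarrow> 0" "q \<longlonglongrightarrow> 0" for p q :: "nat \<Rightarrow> real" and c d
  proof -
    have "(\<lambda>k. z + p k *\<^sub>R a + q k *\<^sub>R b) \<longlonglongrightarrow> z + 0 *\<^sub>R a + 0 *\<^sub>R b"
      by (intro tendsto_intros that)
    then have "(\<lambda>k. f'' (z + p k *\<^sub>R a + q k *\<^sub>R b)) \<longlonglongrightarrow> f'' z"
      using continuous_on_tendsto_compose[OF c] by auto
    then show ?thesis by (intro tendsto_intros)
  qed
  have "(\<lambda>k. f'' (z + p k *\<^sub>R a + q k *\<^sub>R b) b a) \<longlonglongrightarrow> f'' z b a"
    by (rule lim) (use sq pq in blast)+
  moreover have "(\<lambda>k. f'' (z + p k *\<^sub>R a + q k *\<^sub>R b) b a) \<longlonglongrightarrow> f'' z a b"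
    unfolding eq by (rule lim) (use sq pq in blast)+
  ultimately show ?thesis using LIMSEQ_unique by blast
qed

lemma D2_eq_second_derivative:
  assumes d1: "\<And>z. (f has_derivative blinfun_apply (f' z)) (at z)"
    and d2: "\<And>z. (f' has_derivative blinfun_apply (f'' z)) (at z)"
  shows "D2 f z a b = f'' z a b"
proof -
  have 1: "frechet_derivative f (at y) b = f' y b" for y
    using frechet_derivative_at[OF d1[of y]] by simp
  have "((\<lambda>y. f' y b) has_derivative (\<lambda>x. f'' z x b)) (at z)"
    using bounded_linear.has_derivative[OF blinfun.bounded_linear_left d2] .
  from frechet_derivative_at[OF this] show ?thesis
    unfolding D2_def 1 by metis
qed

text \<open>
  The chain rule for an affine symmetry \<open>\<sigma>\<close> of \<open>f\<close>, with linear part \<open>A\<close>.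
\<close>

lemma second_derivative_invariant:
  fixes f :: "'a::real_normed_vector \<Rightarrow> real"
  assumes d1: "\<And>z. (f has_derivative blinfun_apply (f' z)) (at z)"
    and d2: "\<And>z. (f' has_derivative blinfun_apply (f'' z)) (at z)"
    and A: "bounded_linear A" and \<sigma>: "\<And>z. \<sigma> z = w + A z"
    and inv: "\<And>z. f (\<sigma> z) = f z"
  shows "f'' z a b = f'' (\<sigma> z) (A a) (A b)"
proof -
  have d\<sigma>: "(\<sigma> has_derivative A) (at z)" for z
    unfolding \<sigma>[abs_def] using A by (auto intro!: derivative_eq_intros bounded_linear_imp_has_derivative)
  have 1: "f' z b = f' (\<sigma> z) (A b)" for z
  proof -
    have "(f has_derivative (\<lambda>x. f' (\<sigma> z) (A x))) (at z)"
      using has_derivative_compose[OF d\<sigma> d1, of z] by (simp add: inv)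
    from has_derivative_unique[OF this d1] show ?thesis by metis
  qed
  have "((\<lambda>z. f' z b) has_derivative (\<lambda>x. f'' z x b)) (at z)"
    using bounded_linear.has_derivative[OF blinfun.bounded_linear_left d2] .
  moreover have "((\<lambda>z. f' (\<sigma> z) (A b)) has_derivative (\<lambda>x. f'' (\<sigma> z) (A x) (A b))) (at z)"
    using bounded_linear.has_derivative[OF blinfun.bounded_linear_left has_derivative_compose[OF d\<sigma> d2]] .
  ultimately have "(\<lambda>x. f'' z x b) = (\<lambda>x. f'' (\<sigma> z) (A x) (A b))"
    unfolding 1[symmetric] by (rule has_derivative_unique)
  then show ?thesis by metis
qed

section \<open>The variational inequality and its transport by symmetries\<close>

text \<open>
  The hypothesis on the Sturm operator in the form that can be transported: a lower bound for an
  action integral on \<open>[a, b]\<close> by a difference of boundary values, for \<open>C\<^sup>1\<close> functions without any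
  boundary condition. Because the bound is a difference, it telescopes over adjacent intervals.
\<close>

definition boundary_dominated ::
  "(real \<Rightarrow> 'v::real_normed_vector \<Rightarrow> 'v \<Rightarrow> real) \<Rightarrow> (real \<Rightarrow> 'v \<Rightarrow> real) \<Rightarrow> real \<Rightarrow> real \<Rightarrow> bool" where
  "boundary_dominated \<phi> q a b \<longleftrightarrow> (\<forall>u v.
     (\<forall>t\<in>{a..b}. (u has_vector_derivative v t) (at t within {a..b})) \<longrightarrow> continuous_on {a..b} v \<longrightarrow>
     q b (u b) - q a (u a) \<le> integral {a..b} (\<lambda>t. \<phi> t (u t) (v t)))"

lemma boundary_dominatedD:
  assumes "boundary_dominated \<phi> q a b"
    and "\<And>t. t \<in> {a..b} \<Longrightarrow> (u has_vector_derivative v t) (at t within {a..b})"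
    and "continuous_on {a..b} v"
  shows "q b (u b) - q a (u a) \<le> integral {a..b} (\<lambda>t. \<phi> t (u t) (v t))"
  using assms unfolding boundary_dominated_def by blast

lemma continuous_on_density:
  assumes "continuous_on UNIV (\<lambda>(t, x, v). \<phi> t x v)"
    and u: "\<And>t. t \<in> X \<Longrightarrow> (u has_vector_derivative v t) (at t within X)"
    and v: "continuous_on X v"
  shows "continuous_on X (\<lambda>t. \<phi> t (u t) (v t))"
proof -
  have "continuous_on X u"
    using u has_vector_derivative_continuous continuous_on_eq_continuous_within by blast
  then have "continuous_on X (\<lambda>t. (t, u t, v t))" by (intro continuous_intros v)
  from continuous_on_compose2[OF assms(1) this] show ?thesis by simp
qed

lemma boundary_dominated_combine:
  fixes \<phi> :: "real \<Rightarrow> 'v::real_normed_vector \<Rightarrow> 'v \<Rightarrow> real"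
  assumes cont: "continuous_on UNIV (\<lambda>(t, x, v). \<phi> t x v)"
    and ab: "boundary_dominated \<phi> q a b" and bc: "boundary_dominated \<phi> q b c" and le: "a \<le> b" "b \<le> c"
  shows "boundary_dominated \<phi> q a c"
  unfolding boundary_dominated_def
proof (intro allI impI)
  fix u v :: "real \<Rightarrow> 'v"
  assume u: "\<forall>t\<in>{a..c}. (u has_vector_derivative v t) (at t within {a..c})" and v: "continuous_on {a..c} v"
  have sub: "{a..b} \<subseteq> {a..c}" "{b..c} \<subseteq> {a..c}" using le by auto
  have "q b (u b) - q a (u a) \<le> integral {a..b} (\<lambda>t. \<phi> t (u t) (v t))"
    by (rule boundary_dominatedD[OF ab])
      (use u v sub in \<open>blast intro: has_vector_derivative_within_subset continuous_on_subset\<close>)+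
  moreover have "q c (u c) - q b (u b) \<le> integral {b..c} (\<lambda>t. \<phi> t (u t) (v t))"
    by (rule boundary_dominatedD[OF bc])
      (use u v sub in \<open>blast intro: has_vector_derivative_within_subset continuous_on_subset\<close>)+
  moreover have "integral {a..b} (\<lambda>t. \<phi> t (u t) (v t)) + integral {b..c} (\<lambda>t. \<phi> t (u t) (v t))
      = integral {a..c} (\<lambda>t. \<phi> t (u t) (v t))"
    by (rule Henstock_Kurzweil_Integration.integral_combine[OF le])
      (intro integrable_continuous_real continuous_on_density[OF cont] v, use u in auto)
  ultimately show "q c (u c) - q a (u a) \<le> integral {a..c} (\<lambda>t. \<phi> t (u t) (v t))" by linarith
qed

text \<open>
  Translations (\<open>e = 1\<close>) and reflections (\<open>e = -1\<close>) of the time axis are treated together, by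
  substituting \<open>t \<mapsto> A (u (h + e t))\<close>. A reflection exchanges the end points, and this is
  compensated by the sign \<open>e\<close> in the hypothesis on \<open>q\<close>.
\<close>

lemma boundary_dominated_isometry:
  fixes \<phi> :: "real \<Rightarrow> 'v::real_normed_vector \<Rightarrow> 'v \<Rightarrow> real"
  assumes cont: "continuous_on UNIV (\<lambda>(t, x, v). \<phi> t x v)"
    and ab: "boundary_dominated \<phi> q a b" "a \<le> b"
    and A: "bounded_linear A" and e: "e = 1 \<or> e = -1"
    and \<phi>: "\<And>t x v. \<phi> (h + e * t) x v = \<phi> t (A x) (e *\<^sub>R A v)"
    and q: "\<And>t x. q (h + e * t) x = e * q t (A x)"
  shows "boundary_dominated \<phi> q (min (h + e * a) (h + e * b)) (max (h + e * a) (h + e * b))"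
  unfolding boundary_dominated_def
proof (intro allI impI)
  fix u v :: "real \<Rightarrow> 'v"
  let ?c = "min (h + e * a) (h + e * b)" and ?d = "max (h + e * a) (h + e * b)"
  assume u: "\<forall>t\<in>{?c..?d}. (u has_vector_derivative v t) (at t within {?c..?d})" and v: "continuous_on {?c..?d} v"
  let ?g = "\<lambda>t. h + e * t"
  have img: "?g ` {a..b} = {?c..?d}"
    using image_affinity_atLeastAtMost[of e h a b] e \<open>a \<le> b\<close> by (auto simp: add.commute min_def max_def)
  have in_img: "?g t \<in> {?c..?d}" if "t \<in> {a..b}" for t using img that by blast
  have dg: "(?g has_vector_derivative e) (at t within {a..b})" for t
    by (auto intro!: derivative_eq_intros)
  have 1: "q b (A (u (?g b))) - q a (A (u (?g a)))
      \<le> integral {a..b} (\<lambda>t. \<phi> t (A (u (?g t))) (e *\<^sub>R A (v (?g t))))"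
  proof (rule boundary_dominatedD[OF ab(1)])
    fix t assume t: "t \<in> {a..b}"
    have "(u has_vector_derivative v (?g t)) (at (?g t) within ?g ` {a..b})"
      using u in_img[OF t] unfolding img by blast
    from vector_diff_chain_within[OF dg this]
    have "((\<lambda>t. u (?g t)) has_vector_derivative e *\<^sub>R v (?g t)) (at t within {a..b})" by (simp add: o_def)
    from bounded_linear.has_vector_derivative[OF A this]
    show "((\<lambda>t. A (u (?g t))) has_vector_derivative e *\<^sub>R A (v (?g t))) (at t within {a..b})"
      by (simp add: linear_cmul[OF bounded_linear.linear[OF A]])
  next
    have "continuous_on {a..b} (\<lambda>t. v (?g t))"
      by (rule continuous_on_compose2[OF v]) (use in_img in \<open>auto intro!: continuous_intros\<close>)
    then show "continuous_on {a..b} (\<lambda>t. e *\<^sub>R A (v (?g t)))"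
      by (intro continuous_intros bounded_linear.continuous_on[OF A])
  qed
  have "continuous_on {?c..?d} (\<lambda>t. \<phi> t (u t) (v t))"
    by (rule continuous_on_density[OF cont]) (use u v in blast)+
  then have "((\<lambda>t. \<phi> t (u t) (v t)) has_integral integral {?c..?d} (\<lambda>t. \<phi> t (u t) (v t))) (cbox ?c ?d)"
    by (simp add: integrable_integral integrable_continuous_real)
  from has_integral_affinity[OF this, of e h]
  have "((\<lambda>t. \<phi> (e *\<^sub>R t + h) (u (e *\<^sub>R t + h)) (v (e *\<^sub>R t + h))) has_integral
      integral {?c..?d} (\<lambda>t. \<phi> t (u t) (v t))) ((\<lambda>x. (1 / e) *\<^sub>R x + - ((1 / e) *\<^sub>R h)) ` {?c..?d})"
    using e by auto
  moreover have "(\<lambda>x. (1 / e) *\<^sub>R x + - ((1 / e) *\<^sub>R h)) ` {?c..?d} = {a..b}"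
    unfolding img[symmetric] image_image using e by auto
  ultimately have "((\<lambda>t. \<phi> (?g t) (u (?g t)) (v (?g t))) has_integral
      integral {?c..?d} (\<lambda>t. \<phi> t (u t) (v t))) {a..b}"
    by (simp add: add.commute)
  then have "integral {a..b} (\<lambda>t. \<phi> t (A (u (?g t))) (e *\<^sub>R A (v (?g t))))
      = integral {?c..?d} (\<lambda>t. \<phi> t (u t) (v t))"
    unfolding \<phi> by (rule integral_unique)
  with 1 have 2: "q b (A (u (?g b))) - q a (A (u (?g a))) \<le> integral {?c..?d} (\<lambda>t. \<phi> t (u t) (v t))" by simp
  show "q ?d (u ?d) - q ?c (u ?c) \<le> integral {?c..?d} (\<lambda>t. \<phi> t (u t) (v t))"
    using e
  proof
    assume e1: "e = 1"
    then have "?c = ?g a" "?d = ?g b" using \<open>a \<le> b\<close> by auto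
    then show ?thesis using 2 q[of a] q[of b] by (simp only: e1 mult_1)
  next
    assume e1: "e = -1"
    then have "?c = ?g b" "?d = ?g a" using \<open>a \<le> b\<close> by auto
    then show ?thesis using 2 q[of a "u (?g a)"] q[of b "u (?g b)"] by (simp add: e1)
  qed
qed

lemma boundary_dominated_shift:
  fixes \<phi> :: "real \<Rightarrow> 'v::real_normed_vector \<Rightarrow> 'v \<Rightarrow> real"
  assumes "continuous_on UNIV (\<lambda>(t, x, v). \<phi> t x v)"
    and "boundary_dominated \<phi> q a b" "a \<le> b" and "bounded_linear A"
    and "\<And>t x v. \<phi> (t + h) x v = \<phi> t (A x) (A v)" and "\<And>t x. q (t + h) x = q t (A x)"
  shows "boundary_dominated \<phi> q (a + h) (b + h)"
  using boundary_dominated_isometry[where \<phi> = \<phi> and q = q and A = A, OF assms(1-4), of 1 h] assms(3,5,6) by (simp add: add.commute)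

lemma boundary_dominated_reflect:
  fixes \<phi> :: "real \<Rightarrow> 'v::real_normed_vector \<Rightarrow> 'v \<Rightarrow> real"
  assumes "continuous_on UNIV (\<lambda>(t, x, v). \<phi> t x v)"
    and "boundary_dominated \<phi> q a b" "a \<le> b" and "bounded_linear A"
    and "\<And>t x v. \<phi> (h - t) x v = \<phi> t (A x) (- A v)" and "\<And>t x. q (h - t) x = - q t (A x)"
  shows "boundary_dominated \<phi> q (h - b) (h - a)"
  using boundary_dominated_isometry[where \<phi> = \<phi> and q = q and A = A, OF assms(1-4), of "-1" h] assms(3,5,6) by simp

text \<open>
  Reflecting \<open>[0, h]\<close> at \<open>h\<close> yields the cell \<open>[0, 2h]\<close>, and \<open>n\<close> translates of the cell cover the
  period.
\<close>

lemma boundary_dominated_dihedral: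
  fixes \<phi> :: "real \<Rightarrow> 'v::real_normed_vector \<Rightarrow> 'v \<Rightarrow> real"
  assumes cont: "continuous_on UNIV (\<lambda>(t, x, v). \<phi> t x v)"
    and bd: "boundary_dominated \<phi> q 0 h" and h: "0 \<le> h"
    and A: "bounded_linear A" "bounded_linear B"
    and shift: "\<And>t x v. \<phi> (t + 2 * h) x v = \<phi> t (A x) (A v)" "\<And>t x. q (t + 2 * h) x = q t (A x)"
    and refl: "\<And>t x v. \<phi> (2 * h - t) x v = \<phi> t (B x) (- B v)" "\<And>t x. q (2 * h - t) x = - q t (B x)"
    and "1 \<le> n"
  shows "boundary_dominated \<phi> q 0 (real n * (2 * h))"
proof -
  have "boundary_dominated \<phi> q h (2 * h)"
    using boundary_dominated_reflect[where \<phi> = \<phi> and q = q and A = B and h = "2 * h", OF cont bd h A(2) refl] by simp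
  then have cell0: "boundary_dominated \<phi> q 0 (2 * h)"
    using boundary_dominated_combine[where \<phi> = \<phi> and q = q, OF cont bd] h by simp
  have cell: "boundary_dominated \<phi> q (real k * (2 * h)) (real k * (2 * h) + 2 * h)" for k
  proof (induction k)
    case 0 show ?case using cell0 by simp
  next
    case (Suc k)
    have "boundary_dominated \<phi> q (real k * (2 * h) + 2 * h) (real k * (2 * h) + 2 * h + 2 * h)"
      by (rule boundary_dominated_shift[where \<phi> = \<phi> and q = q and A = A and h = "2 * h", OF cont Suc _ A(1) shift])
        (use h in simp)
    then show ?case by (simp add: algebra_simps)
  qed
  show ?thesis using \<open>1 \<le> n\<close>
  proof (induction n rule: dec_induct)
    case base show ?case using cell0 by simp
  next
    case (step k)
    have "boundary_dominated \<phi> q 0 (real k * (2 * h) + 2 * h)"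
      by (rule boundary_dominated_combine[where \<phi> = \<phi> and q = q, OF cont step(3) cell]) (use h in auto)
    then show ?case by (simp add: algebra_simps)
  qed
qed

section \<open>Density of the Neumann functions\<close>

text \<open>
  Polynomial approximations of \<open>v\<close> are multiplied by the polynomial cutoff
  \<open>1 - (1 - t(h - t)/h\<^sup>2)\<^sup>k\<close>, which takes values in \<open>[0, 1]\<close>, vanishes at both end points and tends
  to \<open>1\<close> strictly between them. Bounded pointwise convergence on the open interval is all that
  dominated convergence asks for.
\<close>

lemma cutoff_approximation:
  fixes v :: "real \<Rightarrow> 'v::euclidean_space"
  assumes h: "0 < h" and v: "continuous_on {0..h} v"
  obtains w w' V where "\<And>k t. (w k has_vector_derivative w' k t) (at t)"
    "\<And>k. continuous_on UNIV (w' k)"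
    "\<And>k. w k 0 = 0" "\<And>k. w k h = 0" "\<And>k t. t \<in> {0..h} \<Longrightarrow> norm (w k t) \<le> V"
    "\<And>t. 0 < t \<Longrightarrow> t < h \<Longrightarrow> (\<lambda>k::nat. w k t) \<longlonglongrightarrow> v t"
proof -
  have "\<exists>p. polynomial_function p \<and> (\<forall>t\<in>{0..h}. norm (v t - p t) < 1 / real (Suc k))" for k
    by (rule Stone_Weierstrass_polynomial_function) (use v in auto)
  then obtain p where p: "\<And>k. polynomial_function (p k)"
    "\<And>k t. t \<in> {0..h} \<Longrightarrow> norm (v t - p k t) < 1 / real (Suc k)"
    by metis
  define \<eta> where "\<eta> k t = 1 - (1 - t * (h - t) / h\<^sup>2) ^ Suc k" for k :: nat and t :: real
  define w where "w k t = \<eta> k t *\<^sub>R p k t" for k t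
  have "polynomial_function (\<eta> k)" for k
    unfolding \<eta>_def real_polynomial_function_eq[symmetric]
    by (intro real_polynomial_function_diff real_polynomial_function_power real_polynomial_function_divide
        real_polynomial_function.intros) (auto intro: real_polynomial_function.intros)
  then have "polynomial_function (w k)" for k
    unfolding w_def by (intro polynomial_function_mult p(1))
  then have "\<exists>w'. polynomial_function w' \<and> (\<forall>t. (w k has_vector_derivative w' t) (at t))" for k
    by (metis has_vector_derivative_polynomial_function)
  then obtain w' where w': "\<And>k. polynomial_function (w' k)"
      "\<And>k t. (w k has_vector_derivative w' k t) (at t)"
    by metis
  have "bounded (v ` {0..h})"
    by (intro compact_imp_bounded compact_continuous_image v) simp
  then obtain V where V: "\<And>t. t \<in> {0..h} \<Longrightarrow> norm (v t) \<le> V"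
    unfolding bounded_iff by (metis imageI)
  have base: "0 \<le> 1 - t * (h - t) / h\<^sup>2 \<and> 1 - t * (h - t) / h\<^sup>2 \<le> 1" if "t \<in> {0..h}" for t
  proof -
    have "t * (h - t) \<le> h * h" using that by (intro mult_mono) auto
    moreover have "0 \<le> t * (h - t)" using that by simp
    ultimately show ?thesis using h by (simp add: field_simps power2_eq_square)
  qed
  have \<eta>1: "\<bar>\<eta> k t\<bar> \<le> 1" if "t \<in> {0..h}" for k t
    using power_le_one[of "1 - t * (h - t) / h\<^sup>2" "Suc k"] zero_le_power[of "1 - t * (h - t) / h\<^sup>2" "Suc k"] base[OF that]
    unfolding \<eta>_def by simp
  have wb: "norm (w k t) \<le> V + 1" if "t \<in> {0..h}" for k t
  proof -
    have "norm (p k t) \<le> norm (v t) + norm (v t - p k t)"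
      by (metis norm_minus_commute norm_triangle_sub)
    also have "\<dots> \<le> V + 1 / real (Suc k)" using V[OF that] p(2)[OF that, of k] by simp
    also have "1 / real (Suc k) \<le> 1" by simp
    finally have "norm (p k t) \<le> V + 1" by simp
    moreover have "\<bar>\<eta> k t\<bar> * norm (p k t) \<le> norm (p k t)"
      using mult_right_mono[OF \<eta>1[OF that], of "norm (p k t)" k] by simp
    ultimately show ?thesis by (simp add: w_def)
  qed
  have lim: "(\<lambda>k. w k t) \<longlonglongrightarrow> v t" if t: "0 < t" "t < h" for t
  proof -
    have "0 < t * (h - t) / h\<^sup>2" using t h by simp
    with base[of t] t have "(\<lambda>k. (1 - t * (h - t) / h\<^sup>2) ^ Suc k) \<longlonglongrightarrow> 0"
      by (intro LIMSEQ_Suc LIMSEQ_power_zero) auto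
    then have 1: "(\<lambda>k. \<eta> k t) \<longlonglongrightarrow> 1 - 0" unfolding \<eta>_def by (intro tendsto_intros)
    have "(\<lambda>k. v t - p k t) \<longlonglongrightarrow> 0"
    proof (rule Lim_null_comparison)
      show "\<forall>\<^sub>F k in sequentially. norm (v t - p k t) \<le> 1 / real (Suc k)"
        using p(2)[of t] t by (intro always_eventually) (auto intro: less_imp_le)
      show "(\<lambda>k. 1 / real (Suc k)) \<longlonglongrightarrow> 0" using LIMSEQ_Suc[OF lim_1_over_n] by simp
    qed
    from tendsto_diff[OF tendsto_const[of "v t"] this] have 2: "(\<lambda>k. p k t) \<longlonglongrightarrow> v t" by simp
    from tendsto_scaleR[OF 1 2] show ?thesis unfolding w_def by simp
  qed
  show thesis
  proof (rule that[OF w'(2) _ _ _ wb lim])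
    show "continuous_on UNIV (w' k)" for k
      by (rule continuous_on_polymonial_function[OF w'(1)])
    show "w k 0 = 0" "w k h = 0" for k by (simp_all add: w_def \<eta>_def)
  qed
qed

text \<open>
  The functions \<open>u\<close> whose derivative vanishes at both ends are dense for this inequality: replace
  \<open>u'\<close> by the approximations of the previous lemma and integrate from \<open>u(0)\<close>. Both sides of the
  inequality pass to the limit, as \<open>q\<close> involves only the values of \<open>u\<close>.
\<close>

lemma boundary_dominated_by_density:
  fixes \<phi> :: "real \<Rightarrow> 'v::euclidean_space \<Rightarrow> 'v \<Rightarrow> real"
  assumes cont: "continuous_on UNIV (\<lambda>(t, x, v). \<phi> t x v)" and q: "\<And>t. continuous_on UNIV (q t)"
    and h: "0 < h"
    and smooth: "\<And>u v w. (\<And>t. t \<in> {0..h} \<Longrightarrow> (u has_vector_derivative v t) (at t within {0..h})) \<Longrightarrow>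
      (\<And>t. t \<in> {0..h} \<Longrightarrow> (v has_vector_derivative w t) (at t within {0..h})) \<Longrightarrow>
      continuous_on {0..h} w \<Longrightarrow> v 0 = 0 \<Longrightarrow> v h = 0 \<Longrightarrow>
      q h (u h) - q 0 (u 0) \<le> integral {0..h} (\<lambda>t. \<phi> t (u t) (v t))"
  shows "boundary_dominated \<phi> q 0 h"
  unfolding boundary_dominated_def
proof (intro allI impI)
  fix u v :: "real \<Rightarrow> 'v"
  assume u: "\<forall>t\<in>{0..h}. (u has_vector_derivative v t) (at t within {0..h})" and v: "continuous_on {0..h} v"
  obtain w w' V where w: "\<And>k t. (w k has_vector_derivative w' k t) (at t)"
    and w': "\<And>k. continuous_on UNIV (w' k)"
    and ends: "\<And>k. w k 0 = 0" "\<And>k. w k h = 0" and V: "\<And>k t. t \<in> {0..h} \<Longrightarrow> norm (w k t) \<le> V"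
    and lim: "\<And>t. 0 < t \<Longrightarrow> t < h \<Longrightarrow> (\<lambda>k::nat. w k t) \<longlonglongrightarrow> v t"
    using cutoff_approximation[OF h v] by metis
  have V0: "0 \<le> V" using V[of 0 0] h norm_ge_zero order_trans by (metis atLeastAtMost_iff less_imp_le order_refl)
  have cw: "continuous_on X (w k)" for k X
    by (intro continuous_at_imp_continuous_on ballI has_vector_derivative_continuous[OF w])
  define U where "U k t = u 0 + integral {0..t} (w k)" for k t
  have dU: "(U k has_vector_derivative w k t) (at t within {0..h})" if "t \<in> {0..h}" for k t
    unfolding U_def using integral_has_vector_derivative[OF cw that, of k]
    by (auto intro!: derivative_eq_intros)
  have Ub: "norm (U k t) \<le> norm (u 0) + V * h" if t: "t \<in> {0..h}" for k t
  proof -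
    have "norm (integral {0..t} (w k)) \<le> V * (t - 0)"
      by (rule integral_bound) (use t V in \<open>auto intro: cw\<close>)
    also have "\<dots> \<le> V * h" using t V0 by (simp add: mult_left_mono)
    finally show ?thesis unfolding U_def by (meson add_left_mono norm_triangle_le)
  qed
  have Ulim: "(\<lambda>k. U k t) \<longlonglongrightarrow> u t" if t: "t \<in> {0..h}" for t
  proof -
    have "(\<lambda>k. integral {0<..<t} (w k)) \<longlonglongrightarrow> integral {0<..<t} v"
    proof (rule dominated_convergence(2))
      show "w k integrable_on {0<..<t}" for k
        unfolding integrable_on_Icc_iff_Ioo[symmetric] by (intro integrable_continuous_real cw)
      show "(\<lambda>_. V) integrable_on {0<..<t}"
        unfolding integrable_on_Icc_iff_Ioo[symmetric] by (rule integrable_const_ivl)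
      show "norm (w k x) \<le> V" if "x \<in> {0<..<t}" for k x by (rule V) (use that t in auto)
      show "(\<lambda>k. w k x) \<longlonglongrightarrow> v x" if "x \<in> {0<..<t}" for x by (rule lim) (use that t in auto)
    qed
    then have "(\<lambda>k. U k t) \<longlonglongrightarrow> u 0 + integral {0..t} v"
      unfolding U_def integral_open_interval_real by (intro tendsto_intros)
    moreover have "(v has_integral (u t - u 0)) {0..t}"
    proof (rule fundamental_theorem_of_calculus)
      show "(u has_vector_derivative v x) (at x within {0..t})" if "x \<in> {0..t}" for x
        by (rule has_vector_derivative_within_subset[where S = "{0..h}"]) (use u t that in auto)
    qed (use t in auto)
    ultimately show ?thesis by (simp add: integral_unique)
  qed
  have ineq: "q h (U k h) - q 0 (U k 0) \<le> integral {0<..<h} (\<lambda>t. \<phi> t (U k t) (w k t))" for k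
    unfolding integral_open_interval_real[symmetric]
    by (rule smooth[OF dU has_vector_derivative_at_within[OF w] continuous_on_subset[OF w']])
      (use ends in auto)
  \<comment> \<open>All approximations take values in one compact set, on which \<open>\<phi>\<close> is bounded.\<close>
  define C where "C = {0..h} \<times> cball (0::'v) (norm (u 0) + V * h) \<times> cball (0::'v) V"
  have "compact C" unfolding C_def by (intro compact_Times compact_Icc compact_cball)
  then have "bounded ((\<lambda>(t, x, v). \<phi> t x v) ` C)"
    by (intro compact_imp_bounded compact_continuous_image continuous_on_subset[OF cont]) auto
  then obtain K where "\<forall>z\<in>(\<lambda>(t, x, v). \<phi> t x v) ` C. norm z \<le> K"
    unfolding bounded_iff by auto
  then have K: "norm (\<phi> t (U k t) (w k t)) \<le> K" if "t \<in> {0..h}" for k t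
    using Ub[OF that, of k] V[OF that, of k] that unfolding C_def by force
  have "(\<lambda>k. integral {0<..<h} (\<lambda>t. \<phi> t (U k t) (w k t))) \<longlonglongrightarrow> integral {0<..<h} (\<lambda>t. \<phi> t (u t) (v t))"
  proof (rule dominated_convergence(2))
    show "(\<lambda>t. \<phi> t (U k t) (w k t)) integrable_on {0<..<h}" for k
      unfolding integrable_on_Icc_iff_Ioo[symmetric]
      by (intro integrable_continuous_real continuous_on_density[OF cont] dU cw)
    show "(\<lambda>_. K) integrable_on {0<..<h}"
      unfolding integrable_on_Icc_iff_Ioo[symmetric] by (rule integrable_const_ivl)
    show "norm (\<phi> t (U k t) (w k t)) \<le> K" if "t \<in> {0<..<h}" for k t by (rule K) (use that in auto)
    show "(\<lambda>k. \<phi> t (U k t) (w k t)) \<longlonglongrightarrow> \<phi> t (u t) (v t)" if t: "t \<in> {0<..<h}" for t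
    proof -
      have "(\<lambda>k. (t, U k t, w k t)) \<longlonglongrightarrow> (t, u t, v t)"
        by (intro tendsto_intros Ulim lim) (use t in auto)
      from continuous_on_tendsto_compose[OF cont this] show ?thesis by simp
    qed
  qed
  moreover have "(\<lambda>k. q h (U k h) - q 0 (U k 0)) \<longlonglongrightarrow> q h (u h) - q 0 (u 0)"
    by (intro tendsto_diff continuous_on_tendsto_compose[OF q] Ulim) (use h in auto)
  ultimately show "q h (u h) - q 0 (u 0) \<le> integral {0..h} (\<lambda>t. \<phi> t (u t) (v t))"
    unfolding integral_open_interval_real using ineq by (intro LIMSEQ_le) auto
qed

section \<open>The quadratic form of the Sturm operator\<close>

text \<open>
  Embeds real functions, on which the pairing is a real quadratic form, into the complex-valued
  functions on which the Sturm operator acts.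
\<close>

definition cvec :: "real^'m \<Rightarrow> complex^'m" where
  "cvec u = (\<chi> i. complex_of_real (u $ i))"

lemma cmul_cvec: "A *c cvec u = cvec (A *v u)"
  by (simp add: cvec_def matrix_vector_mult_def vec_eq_iff)

lemma cvec_add: "cvec (a + b) = cvec a + cvec b"
  by (simp add: cvec_def vec_eq_iff)

lemma cinner_cvec: "cinner (cvec a) (cvec b) = complex_of_real (a \<bullet> b)"
  by (simp add: cvec_def cinner_def inner_vec_def)

lemma bounded_linear_cvec: "bounded_linear (cvec :: real^'m \<Rightarrow> complex^'m)"
  by (auto simp: cvec_def vec_eq_iff linear_iff complex_eq_iff intro!: linear_conv_bounded_linear[THEN iffD1])

lemma cvec_0: "cvec 0 = 0"
  by (simp add: cvec_def vec_eq_iff)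

lemma cvec_in_E2:
  fixes u v w :: "real \<Rightarrow> real^'m"
  assumes h: "0 < h"
    and u: "\<And>t. t \<in> {0..h} \<Longrightarrow> (u has_vector_derivative v t) (at t within {0..h})"
    and v: "\<And>t. t \<in> {0..h} \<Longrightarrow> (v has_vector_derivative w t) (at t within {0..h})"
    and w: "continuous_on {0..h} w" and ends: "v 0 = 0" "v h = 0"
  shows "(\<lambda>t. cvec (u t)) \<in> E2 h"
    and "\<And>t. t \<in> {0..h} \<Longrightarrow> deriv_on 0 h (\<lambda>t. cvec (u t)) t = cvec (v t)"
proof -
  let ?U = "\<lambda>t. cvec (u t)"
  have dU: "(?U has_vector_derivative cvec (v t)) (at t within {0..h})" if "t \<in> {0..h}" for t
    by (rule bounded_linear.has_vector_derivative[OF bounded_linear_cvec u[OF that]])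
  then show deriv: "deriv_on 0 h ?U t = cvec (v t)" if "t \<in> {0..h}" for t
    using h that vector_derivative_within_closed_interval by blast
  have cw: "continuous_on {0..h} (\<lambda>t. cvec (w t))"
    by (rule bounded_linear.continuous_on[OF bounded_linear_cvec w])
  have dv: "((\<lambda>t. cvec (v t)) has_vector_derivative cvec (w t)) (at t within {0..h})" if "t \<in> {0..h}" for t
    by (rule bounded_linear.has_vector_derivative[OF bounded_linear_cvec v[OF that]])
  have "?U \<in> W22 0 h"
    unfolding W22_def
  proof (intro CollectI conjI ballI exI[of _ "\<lambda>t. cvec (w t)"])
    show "?U differentiable at t within {0..h}" if "t \<in> {0..h}" for t
      using dU[OF that] differentiableI_vector by blast
    show "(\<lambda>t. cvec (w t)) absolutely_integrable_on {0..h}"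
      by (rule absolutely_integrable_continuous_real[OF cw])
    show "(\<lambda>t. (norm (cvec (w t)))\<^sup>2) integrable_on {0..h}"
      by (intro integrable_continuous_real continuous_intros cw)
    show "((\<lambda>t. cvec (w t)) has_integral deriv_on 0 h ?U t - deriv_on 0 h ?U 0) {0..t}" if t: "t \<in> {0..h}" for t
    proof -
      have "((\<lambda>t. cvec (w t)) has_integral cvec (v t) - cvec (v 0)) {0..t}"
      proof (rule fundamental_theorem_of_calculus)
        show "((\<lambda>t. cvec (v t)) has_vector_derivative cvec (w x)) (at x within {0..t})" if "x \<in> {0..t}" for x
          by (rule has_vector_derivative_within_subset[OF dv]) (use t that in auto)
      qed (use t in auto)
      then show ?thesis using deriv[of t] deriv[of 0] t h by simp
    qed
  qed
  then show "?U \<in> E2 h"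
    unfolding E2_def using deriv[of 0] deriv[of h] h ends by (simp add: cvec_0)
qed

definition sturm_density ::
  "(real \<Rightarrow> real^'m^'m) \<Rightarrow> (real \<Rightarrow> real^'m^'m) \<Rightarrow> (real \<Rightarrow> real^'m^'m) \<Rightarrow>
   real \<Rightarrow> real^'m \<Rightarrow> real^'m \<Rightarrow> real" where
  "sturm_density P Q R t x v = (P t *v v) \<bullet> v + 2 * ((Q t *v x) \<bullet> v) + (R t *v x) \<bullet> x"

definition boundary_form :: "(real \<Rightarrow> real^'m^'m) \<Rightarrow> real \<Rightarrow> real^'m \<Rightarrow> real" where
  "boundary_form Q t x = (Q t *v x) \<bullet> x"

lemma continuous_on_sturm_density:
  assumes "continuous_on UNIV P" "continuous_on UNIV Q" "continuous_on UNIV R"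
  shows "continuous_on UNIV (\<lambda>(t, x, v). sturm_density P Q R t x v)"
  unfolding sturm_density_def case_prod_beta
  by (intro continuous_intros continuous_on_mat_vec continuous_on_compose2[OF assms(1)]
      continuous_on_compose2[OF assms(2)] continuous_on_compose2[OF assms(3)]) auto

text \<open>
  As \<open>v\<close> vanishes at the end points, the momenta there are \<open>Q u\<close>, so the boundary terms of the
  pairing are differences of values of \<open>boundary_form\<close>.
\<close>

lemma sturm_pairing_cvec:
  fixes u v w :: "real \<Rightarrow> real^'m"
  assumes h: "0 < h"
    and u: "\<And>t. t \<in> {0..h} \<Longrightarrow> (u has_vector_derivative v t) (at t within {0..h})"
    and v: "\<And>t. t \<in> {0..h} \<Longrightarrow> (v has_vector_derivative w t) (at t within {0..h})"
    and w: "continuous_on {0..h} w" and ends: "v 0 = 0" "v h = 0"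
    and PQR: "continuous_on UNIV P" "continuous_on UNIV Q" "continuous_on UNIV R"
  shows "sturm_pairing P Q R h (\<lambda>t. cvec (u t)) = complex_of_real
    (integral {0..h} (\<lambda>t. sturm_density P Q R t (u t) (v t)) - (boundary_form Q h (u h) - boundary_form Q 0 (u 0)))"
proof -
  have deriv: "deriv_on 0 h (\<lambda>t. cvec (u t)) t = cvec (v t)" if "t \<in> {0..h}" for t
    by (rule cvec_in_E2(2)[OF h u v w ends that])
  have mom: "momentum P Q h (\<lambda>t. cvec (u t)) t = cvec (P t *v v t + Q t *v u t)" if "t \<in> {0..h}" for t
    unfolding momentum_def deriv[OF that] by (simp add: cmul_cvec cvec_add)
  have cv: "continuous_on {0..h} v"
    using v has_vector_derivative_continuous continuous_on_eq_continuous_within by blast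
  have "continuous_on {0..h} (\<lambda>t. sturm_density P Q R t (u t) (v t))"
    by (rule continuous_on_density[OF continuous_on_sturm_density[OF PQR] u cv])
  then have "((\<lambda>t. sturm_density P Q R t (u t) (v t)) has_integral
      integral {0..h} (\<lambda>t. sturm_density P Q R t (u t) (v t))) {0..h}"
    by (simp add: integrable_integral integrable_continuous_real)
  from has_integral_of_real[OF this, where 'b = complex]
  have int: "((\<lambda>t. cinner (momentum P Q h (\<lambda>t. cvec (u t)) t) (deriv_on 0 h (\<lambda>t. cvec (u t)) t)
       + cinner (transpose (Q t) *c deriv_on 0 h (\<lambda>t. cvec (u t)) t + R t *c cvec (u t)) (cvec (u t))) has_integral
      complex_of_real (integral {0..h} (\<lambda>t. sturm_density P Q R t (u t) (v t)))) {0..h}"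
  proof (rule has_integral_eq[rotated])
    fix t assume t: "t \<in> {0..h}"
    have "(transpose (Q t) *v v t) \<bullet> u t = (Q t *v u t) \<bullet> v t"
      unfolding inner_transpose_left by (rule inner_commute)
    then show "complex_of_real (sturm_density P Q R t (u t) (v t)) =
        cinner (momentum P Q h (\<lambda>t. cvec (u t)) t) (deriv_on 0 h (\<lambda>t. cvec (u t)) t)
       + cinner (transpose (Q t) *c deriv_on 0 h (\<lambda>t. cvec (u t)) t + R t *c cvec (u t)) (cvec (u t))"
      unfolding mom[OF t] deriv[OF t] cmul_cvec cvec_add[symmetric] cinner_cvec of_real_add[symmetric] of_real_eq_iff
      by (simp add: sturm_density_def inner_add_left del: transpose_matrix_vector)
  qed
  show ?thesis
    unfolding sturm_pairing_def integral_unique[OF int]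
    using mom[of 0] mom[of h] h ends by (simp add: cinner_cvec boundary_form_def)
qed

lemma boundary_dominated_of_psd:
  fixes P Q R :: "real \<Rightarrow> real^'m^'m"
  assumes h: "0 < h" and PQR: "continuous_on UNIV P" "continuous_on UNIV Q" "continuous_on UNIV R"
    and psd: "\<And>u. u \<in> E2 h \<Longrightarrow> sturm_pairing P Q R h u \<in> \<real>\<^sub>\<ge>\<^sub>0"
  shows "boundary_dominated (sturm_density P Q R) (boundary_form Q) 0 h"
proof (rule boundary_dominated_by_density[OF continuous_on_sturm_density[OF PQR] _ h])
  show "continuous_on UNIV (boundary_form Q t)" for t
    unfolding boundary_form_def by (intro continuous_intros continuous_on_mat_vec)
  fix u v w :: "real \<Rightarrow> real^'m"
  assume a: "\<And>t. t \<in> {0..h} \<Longrightarrow> (u has_vector_derivative v t) (at t within {0..h})"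
    "\<And>t. t \<in> {0..h} \<Longrightarrow> (v has_vector_derivative w t) (at t within {0..h})"
    "continuous_on {0..h} w" "v 0 = 0" "v h = 0"
  show "boundary_form Q h (u h) - boundary_form Q 0 (u 0) \<le> integral {0..h} (\<lambda>t. sturm_density P Q R t (u t) (v t))"
  proof -
    have "(\<lambda>t. cvec (u t)) \<in> E2 h" by (rule cvec_in_E2(1)[OF h a])
    moreover have "sturm_pairing P Q R h (\<lambda>t. cvec (u t)) = complex_of_real
        (integral {0..h} (\<lambda>t. sturm_density P Q R t (u t) (v t)) - (boundary_form Q h (u h) - boundary_form Q 0 (u 0)))"
      by (rule sturm_pairing_cvec[OF h a PQR])
    ultimately have "complex_of_real
        (integral {0..h} (\<lambda>t. sturm_density P Q R t (u t) (v t)) - (boundary_form Q h (u h) - boundary_form Q 0 (u 0)))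
        \<in> \<real>\<^sub>\<ge>\<^sub>0"
      using psd by metis
    then show ?thesis by (simp add: complex_nonneg_Reals_iff)
  qed
qed

section \<open>The monodromy matrix\<close>

text \<open>
  The Legendre transform read backwards: a trajectory of the Hamiltonian system consists of a \<open>C\<^sup>1\<close>
  function \<open>\<xi>\<close>, with derivative \<open>v\<close>, and its momentum \<open>y = P v + Q \<xi>\<close>, which satisfies the
  linearized Euler-Lagrange equation \<open>y' = Q\<^sup>T v + R \<xi>\<close>.
\<close>

lemma fundamental_solution_trajectory:
  fixes P Q R :: "real \<Rightarrow> real^'m^'m" and z :: "real^('m::finite + 'm)"
  assumes fund: "fundamental_solution (\<lambda>t. B_mat (P t) (Q t) (R t)) T \<gamma>"
    and inv: "\<And>t. invertible (P t)" and cP: "continuous_on UNIV P" and cQ: "continuous_on UNIV Q"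
  shows "\<exists>v. continuous_on {0..T} v \<and> (\<forall>t\<in>{0..T}.
    ((\<lambda>t. snd_half (\<gamma> t *v z)) has_vector_derivative v t) (at t within {0..T}) \<and>
    fst_half (\<gamma> t *v z) = P t *v v t + Q t *v snd_half (\<gamma> t *v z) \<and>
    ((\<lambda>t. fst_half (\<gamma> t *v z)) has_vector_derivative
        transpose (Q t) *v v t + R t *v snd_half (\<gamma> t *v z)) (at t within {0..T}))"
proof -
  let ?x = "\<lambda>t. snd_half (\<gamma> t *v z)" and ?y = "\<lambda>t. fst_half (\<gamma> t *v z)"
  define v where "v t = matrix_inv (P t) *v (?y t - Q t *v ?x t)" for t
  have bl: "bounded_linear (\<lambda>M. M *v z)"
    by (intro linear_conv_bounded_linear[THEN iffD1] linearI)
      (simp_all add: matrix_vector_mult_add_rdistrib scaleR_matrix_vector_assoc[symmetric])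
  have d: "((\<lambda>t. \<gamma> t *v z) has_vector_derivative
      (J_mat ** B_mat (P t) (Q t) (R t) ** \<gamma> t) *v z) (at t within {0..T})" if "t \<in> {0..T}" for t
    using fund that bounded_linear.has_vector_derivative[OF bl] unfolding fundamental_solution_def by blast
  have halves: "fst_half ((J_mat ** B_mat (P t) (Q t) (R t) ** \<gamma> t) *v z) = transpose (Q t) *v v t + R t *v ?x t"
    "snd_half ((J_mat ** B_mat (P t) (Q t) (R t) ** \<gamma> t) *v z) = v t" for t
    unfolding J_mat_def B_mat_def matrix_vector_mul_assoc[symmetric] halves_block_mat_mult v_def
    by (simp_all add: matrix_vector_mul_assoc[symmetric] neg_mat_mult_vec matrix_vector_mult_diff_rdistrib
        matrix_vector_mult_diff_distrib algebra_simps del: transpose_matrix_vector)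
  have dx: "(?x has_vector_derivative v t) (at t within {0..T})"
    and dy: "(?y has_vector_derivative transpose (Q t) *v v t + R t *v ?x t) (at t within {0..T})"
    if "t \<in> {0..T}" for t
    using bounded_linear.has_vector_derivative[OF bounded_linear_snd_half d[OF that]]
      bounded_linear.has_vector_derivative[OF bounded_linear_fst_half d[OF that]]
    unfolding halves by auto
  have solve: "P t *v v t = ?y t - Q t *v ?x t" for t
    by (simp add: v_def matrix_vector_mul_assoc matrix_inv_cancel(1)[OF inv])
  have cx: "continuous_on {0..T} ?x" "continuous_on {0..T} ?y"
    using dx dy has_vector_derivative_continuous continuous_on_eq_continuous_within by blast+
  have "continuous_on {0..T} (\<lambda>t. ?y t - Q t *v ?x t)"
    by (intro continuous_on_diff continuous_on_mat_vec cx continuous_on_subset[OF cQ] subset_UNIV)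
  then have cv: "continuous_on {0..T} v"
    by (rule continuous_on_solve[OF continuous_on_subset[OF cP subset_UNIV] _ inv solve])
  show ?thesis
    by (intro exI[of _ v] conjI ballI cv dx dy) (simp_all add: solve)
qed

text \<open>
  Along two solutions the derivative of \<open>\<langle>y, \<xi>'\<rangle>\<close> (where \<open>\<xi>'\<close> belongs to the second one) is a
  bilinear form that is symmetric when \<open>P\<close> and \<open>R\<close> are, so the symplectic form is constant.
\<close>

lemma fundamental_solution_symplectic:
  fixes P Q R :: "real \<Rightarrow> real^'m^'m"
  assumes fund: "fundamental_solution (\<lambda>t. B_mat (P t) (Q t) (R t)) T \<gamma>" and T: "0 \<le> T"
    and inv: "\<And>t. invertible (P t)" and cP: "continuous_on UNIV P" and cQ: "continuous_on UNIV Q"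
    and sym: "\<And>t. transpose (P t) = P t" "\<And>t. transpose (R t) = R t"
  shows "symplectic (\<gamma> T)"
  unfolding symplectic_iff_symp_form
proof (intro allI)
  fix z w :: "real^('m + 'm)"
  let ?x = "\<lambda>t. snd_half (\<gamma> t *v z)" and ?y = "\<lambda>t. fst_half (\<gamma> t *v z)"
  let ?x' = "\<lambda>t. snd_half (\<gamma> t *v w)" and ?y' = "\<lambda>t. fst_half (\<gamma> t *v w)"
  obtain v where v: "\<And>t. t \<in> {0..T} \<Longrightarrow> (?x has_vector_derivative v t) (at t within {0..T})"
    "continuous_on {0..T} v"
    "\<And>t. t \<in> {0..T} \<Longrightarrow> ?y t = P t *v v t + Q t *v ?x t"
    "\<And>t. t \<in> {0..T} \<Longrightarrow> (?y has_vector_derivative transpose (Q t) *v v t + R t *v ?x t) (at t within {0..T})"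
    using fundamental_solution_trajectory[OF fund inv cP cQ, of z] by blast
  obtain v' where v': "\<And>t. t \<in> {0..T} \<Longrightarrow> (?x' has_vector_derivative v' t) (at t within {0..T})"
    "continuous_on {0..T} v'"
    "\<And>t. t \<in> {0..T} \<Longrightarrow> ?y' t = P t *v v' t + Q t *v ?x' t"
    "\<And>t. t \<in> {0..T} \<Longrightarrow> (?y' has_vector_derivative transpose (Q t) *v v' t + R t *v ?x' t) (at t within {0..T})"
    using fundamental_solution_trajectory[OF fund inv cP cQ, of w] by blast
  have "((\<lambda>t. symp_form (\<gamma> t *v z) (\<gamma> t *v w)) has_vector_derivative 0) (at t within {0..T})"
    if t: "t \<in> {0..T}" for t
  proof -
    have 1: "((\<lambda>t. symp_form (\<gamma> t *v z) (\<gamma> t *v w)) has_vector_derivative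
        (?y t \<bullet> v' t + (transpose (Q t) *v v t + R t *v ?x t) \<bullet> ?x' t)
        - (?x t \<bullet> (transpose (Q t) *v v' t + R t *v ?x' t) + v t \<bullet> ?y' t)) (at t within {0..T})"
      unfolding symp_form_def
      by (intro has_vector_derivative_diff bounded_bilinear.has_vector_derivative[OF bounded_bilinear_inner] v v' t)
    have "(P t *v v t) \<bullet> v' t = v t \<bullet> (P t *v v' t)" "(R t *v ?x t) \<bullet> ?x' t = ?x t \<bullet> (R t *v ?x' t)"
      by (rule symmetric_matrix_inner, rule sym)+
    then have "(?y t \<bullet> v' t + (transpose (Q t) *v v t + R t *v ?x t) \<bullet> ?x' t)
        - (?x t \<bullet> (transpose (Q t) *v v' t + R t *v ?x' t) + v t \<bullet> ?y' t) = 0"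
      unfolding v(3)[OF t] v'(3)[OF t]
      by (simp only: inner_add_left inner_add_right inner_transpose_left inner_transpose_right)
    with 1 show ?thesis by simp
  qed
  then have "symp_form (\<gamma> 0 *v z) (\<gamma> 0 *v w) = symp_form (\<gamma> T *v z) (\<gamma> T *v w)"
    using T by (intro has_derivative_zero_unique[of "{0..T}" "\<lambda>t. symp_form (\<gamma> t *v z) (\<gamma> t *v w)"])
      (auto simp: has_vector_derivative_def)
  then show "symp_form (\<gamma> T *v z) (\<gamma> T *v w) = symp_form z w"
    using fund by (simp add: fundamental_solution_def)
qed

text \<open>
  Along a solution \<open>\<langle>y, \<xi>\<rangle>' = \<phi>(\<xi>, \<xi>')\<close>, so the integral in the variational inequality is the
  increment of \<open>\<langle>y, \<xi>\<rangle>\<close>.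
\<close>

lemma lyapunov_form_le_monodromy:
  fixes P Q R :: "real \<Rightarrow> real^'m^'m"
  assumes fund: "fundamental_solution (\<lambda>t. B_mat (P t) (Q t) (R t)) T \<gamma>" and T: "0 \<le> T"
    and inv: "\<And>t. invertible (P t)" and cP: "continuous_on UNIV P" and cQ: "continuous_on UNIV Q"
    and bd: "boundary_dominated (sturm_density P Q R) (boundary_form Q) 0 T"
    and per: "\<And>x. boundary_form Q T x = boundary_form Q 0 x"
  shows "lyapunov_form (Q 0) z \<le> lyapunov_form (Q 0) (\<gamma> T *v z)"
proof -
  let ?x = "\<lambda>t. snd_half (\<gamma> t *v z)" and ?y = "\<lambda>t. fst_half (\<gamma> t *v z)"
  obtain v where v: "\<And>t. t \<in> {0..T} \<Longrightarrow> (?x has_vector_derivative v t) (at t within {0..T})"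
    "continuous_on {0..T} v"
    "\<And>t. t \<in> {0..T} \<Longrightarrow> ?y t = P t *v v t + Q t *v ?x t"
    "\<And>t. t \<in> {0..T} \<Longrightarrow> (?y has_vector_derivative transpose (Q t) *v v t + R t *v ?x t) (at t within {0..T})"
    using fundamental_solution_trajectory[OF fund inv cP cQ, of z] by blast
  have "((\<lambda>t. ?y t \<bullet> ?x t) has_vector_derivative sturm_density P Q R t (?x t) (v t)) (at t within {0..T})"
    if t: "t \<in> {0..T}" for t
  proof -
    have "((\<lambda>t. ?y t \<bullet> ?x t) has_vector_derivative
        ?y t \<bullet> v t + (transpose (Q t) *v v t + R t *v ?x t) \<bullet> ?x t) (at t within {0..T})"
      by (intro bounded_bilinear.has_vector_derivative[OF bounded_bilinear_inner] v t)
    also have "?y t \<bullet> v t + (transpose (Q t) *v v t + R t *v ?x t) \<bullet> ?x t = sturm_density P Q R t (?x t) (v t)"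
      unfolding v(3)[OF t] sturm_density_def
      by (simp only: inner_add_left inner_transpose_left) (simp add: inner_commute)
    finally show ?thesis .
  qed
  from fundamental_theorem_of_calculus[OF T this]
  have "integral {0..T} (\<lambda>t. sturm_density P Q R t (?x t) (v t)) = ?y T \<bullet> ?x T - ?y 0 \<bullet> ?x 0"
    by (rule integral_unique)
  with boundary_dominatedD[OF bd v(1,2)]
  have "boundary_form Q 0 (?x T) - boundary_form Q 0 (?x 0) \<le> ?y T \<bullet> ?x T - ?y 0 \<bullet> ?x 0"
    by (simp add: per)
  then show ?thesis
    using fund by (simp add: fundamental_solution_def lyapunov_form_def boundary_form_def)
qed

section \<open>Equivariant critical loops\<close>

lemma boundary_form_iterate:
  assumes "\<And>t x. boundary_form Q (t + c) x = boundary_form Q t (S *v x)"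
  shows "boundary_form Q (t + real k * c) x = boundary_form Q t (mat_pow S k *v x)"
proof (induction k arbitrary: t)
  case 0 show ?case by (simp add: mat_pow_0)
next
  case (Suc k)
  have "boundary_form Q (t + real (Suc k) * c) x = boundary_form Q ((t + c) + real k * c) x"
    by (simp add: algebra_simps)
  also have "\<dots> = boundary_form Q t (S *v (mat_pow S k *v x))"
    unfolding Suc assms ..
  finally show ?case by (simp add: mat_pow_Suc matrix_vector_mul_assoc)
qed

text \<open>
  The two generators of the dihedral group are the cases \<open>e = 1\<close> and \<open>e = -1\<close>. Since the loop is
  equivariant, the symmetry of \<open>L\<close> maps its lift at time \<open>t\<close> to its lift at time \<open>c + e t\<close>.
\<close>

lemma second_derivative_along_lift:
  fixes L :: "real \<times> (real^'m) \<times> (real^'m) \<Rightarrow> real" and x :: "real \<Rightarrow> real^'m"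
  assumes d1: "\<And>z. (L has_derivative blinfun_apply (L' z)) (at z)"
    and d2: "\<And>z. (L' has_derivative blinfun_apply (L'' z)) (at z)"
    and inv: "\<And>t q v. L (t, q, v) = L (c + e * t, A *v q, e *\<^sub>R (A *v v))"
    and e: "e = 1 \<or> e = -1"
    and x: "\<And>t. x differentiable (at t)" and equi: "\<And>t. x (c + e * t) = A *v x t"
  shows "L'' (lift x t) (a, b, b') (p, q, q') =
    L'' (lift x (c + e * t)) (e * a, A *v b, e *\<^sub>R (A *v b')) (e * p, A *v q, e *\<^sub>R (A *v q'))"
proof -
  let ?A = "\<lambda>z. (e * fst z, A *v fst (snd z), e *\<^sub>R (A *v snd (snd z)))"
  have A: "bounded_linear ?A"
    by (intro bounded_linear_Pair bounded_linear_const_mult bounded_linear_scaleR_right[THEN bounded_linear_compose]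
        bounded_linear_compose[OF matrix_vector_mul_bounded_linear] bounded_linear_fst bounded_linear_snd
        bounded_linear_compose[OF bounded_linear_fst bounded_linear_snd]
        bounded_linear_compose[OF bounded_linear_snd bounded_linear_snd])
  have "vector_derivative x (at (c + e * t)) = e *\<^sub>R (A *v vector_derivative x (at t))"
  proof -
    have D: "(x has_vector_derivative vector_derivative x (at s)) (at s)" for s
      using x vector_derivative_works by blast
    have "((\<lambda>s. c + e * s) has_vector_derivative e) (at t)"
      by (auto intro!: derivative_eq_intros)
    from vector_diff_chain_at[OF this D]
    have "((\<lambda>s. A *v x s) has_vector_derivative e *\<^sub>R vector_derivative x (at (c + e * t))) (at t)"
      by (simp add: o_def equi)
    moreover have "((\<lambda>s. A *v x s) has_vector_derivative A *v vector_derivative x (at t)) (at t)"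
      by (rule bounded_linear.has_vector_derivative[OF matrix_vector_mul_bounded_linear D])
    ultimately have "e *\<^sub>R vector_derivative x (at (c + e * t)) = A *v vector_derivative x (at t)"
      by (rule vector_derivative_unique_at)
    then have "e *\<^sub>R (A *v vector_derivative x (at t)) = (e * e) *\<^sub>R vector_derivative x (at (c + e * t))"
      by (simp only: scaleR_scaleR[symmetric])
    then show ?thesis using e by auto
  qed
  then have lift: "(c, 0, 0) + ?A (lift x t) = lift x (c + e * t)"
    by (simp add: lift_def equi)
  have "L ((c, 0, 0) + ?A z) = L z" for z
    using inv[of "fst z" "fst (snd z)" "snd (snd z)"] by simp
  then have "L'' (lift x t) (a, b, b') (p, q, q')
      = L'' ((c, 0, 0) + ?A (lift x t)) (?A (a, b, b')) (?A (p, q, q'))"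
    by (intro second_derivative_invariant[where f = L and f' = L' and A = ?A and w = "(c, 0, 0)" and \<sigma> = "\<lambda>z. (c, 0, 0) + ?A z"]
        d1 d2 A refl)
  then show ?thesis unfolding lift by simp
qed

theorem theorem4:
  fixes T :: real and n :: nat
    and S N :: "real^'m^'m"
    and L :: "real \<times> (real^'m) \<times> (real^'m) \<Rightarrow> real"
    and x :: "real \<Rightarrow> real^'m"
  assumes "0 < T" and "1 \<le> n"
    and "orthogonal_matrix S" and "orthogonal_matrix N"
    and "mat_pow S n = mat 1"
    and "N ** N = mat 1" and "(N ** S) ** (N ** S) = mat 1"
    and "C2 L" and "legendre_convex L"
    and "\<And>t q v. L (t, q, v) = L (t - T / real n, S *v q, S *v v)"
    and "\<And>t q v. L (t, q, v) = L (T / real n - t, N *v q, - (N *v v))"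
    and "critical_loop L T x"
    and "S_act S (T / real n) x = x" and "N_act N (T / real n) x = x"
    and "sturm_psd_on_E2 L x (T / (2 * real n))"
  shows "\<not> strongly_stable_orbit L T x"
proof
  assume "strongly_stable_orbit L T x"
  then obtain \<gamma> where \<gamma>: "fundamental_solution (B_along L x) T \<gamma>" and stable: "strongly_stable_mat (\<gamma> T)"
    unfolding strongly_stable_orbit_def by blast
  obtain L' L'' where d1: "\<And>z. (L has_derivative blinfun_apply (L' z)) (at z)"
    and d2: "\<And>z. (L' has_derivative blinfun_apply (L'' z)) (at z)"
    and cL: "continuous_on UNIV L''"
    using \<open>C2 L\<close> unfolding C2_def by blast
  \<comment> \<open>The half cell, between two fixed times of the reflections.\<close>
  define h where "h = T / (2 * real n)"
  have h: "0 < h" "T / real n = 2 * h" "T = real n * (2 * h)"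
    using \<open>0 < T\<close> \<open>1 \<le> n\<close> by (simp_all add: h_def)
  define P Q R where "P t = L_vv L (lift x t)" and "Q t = L_vx L (lift x t)" and "R t = L_xx L (lift x t)" for t
  have sym: "L'' z a b = L'' z b a" for z a b
    by (rule second_derivative_symmetric[OF d1 d2 cL])
  note D2 = D2_eq_second_derivative[OF d1 d2]
  have lin: "linear (\<lambda>v::real^'m. (0::real, 0::real^'m, v))" "linear (\<lambda>v::real^'m. (0::real, v, 0::real^'m))"
    by (rule linearI; simp)+
  have P: "(P t *v v) \<bullet> w = L'' (lift x t) (0, 0, w) (0, 0, v)" for t v w
    using matrix_of_bilinear_inner[OF lin(1) lin(1), of "L'' (lift x t)" v w] by (simp add: P_def L_vv_def D2)
  have Q: "(Q t *v v) \<bullet> w = L'' (lift x t) (0, 0, w) (0, v, 0)" for t v w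
    using matrix_of_bilinear_inner[OF lin(1) lin(2), of "L'' (lift x t)" v w] by (simp add: Q_def L_vx_def D2)
  have R: "(R t *v v) \<bullet> w = L'' (lift x t) (0, w, 0) (0, v, 0)" for t v w
    using matrix_of_bilinear_inner[OF lin(2) lin(2), of "L'' (lift x t)" v w] by (simp add: R_def L_xx_def D2)
  have density: "sturm_density P Q R t y v = L'' (lift x t) (0, y, v) (0, y, v)" for t y v
  proof -
    have "L'' (lift x t) (0, y, v) (0, y, v)
        = L'' (lift x t) ((0, y, 0) + (0, 0, v)) ((0, y, 0) + (0, 0, v))" by simp
    also have "\<dots> = sturm_density P Q R t y v"
      unfolding sturm_density_def P Q R
      by (simp only: blinfun.add_left blinfun.add_right sym[of "lift x t" "(0, y, 0)" "(0, 0, v)"])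
    finally show ?thesis ..
  qed
  have boundary: "boundary_form Q t y = L'' (lift x t) (0, 0, y) (0, y, 0)" for t y
    unfolding boundary_form_def Q ..
  have "x C1_differentiable_on UNIV" using \<open>critical_loop L T x\<close> by (simp add: critical_loop_def C1_loop_def)
  then have x: "x differentiable (at t)" "continuous_on UNIV (\<lambda>t. vector_derivative x (at t))" for t
    unfolding C1_differentiable_on_eq by auto
  have "continuous_on UNIV x"
    using x(1) by (simp add: continuous_at_imp_continuous_on differentiable_imp_continuous_within)
  then have "continuous_on UNIV (lift x)"
    unfolding lift_def by (intro continuous_intros x(2))
  then have cH: "continuous_on UNIV (\<lambda>t. L'' (lift x t) a b)" for a b
    by (intro continuous_intros continuous_on_compose2[OF cL]) auto
  have cont: "continuous_on UNIV P" "continuous_on UNIV Q" "continuous_on UNIV R"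
    unfolding P_def Q_def R_def L_vv_def L_vx_def L_xx_def D2 by (intro continuous_on_vec_lambda cH)+
  have shift: "L'' (lift x (t + 2 * h)) (a, b, b') (p, q, q')
      = L'' (lift x t) (a, S *v b, S *v b') (p, S *v q, S *v q')" for t a b b' p q q'
  proof -
    have "x (- (2 * h) + 1 * s) = S *v x s" for s
      using fun_cong[OF \<open>S_act S (T / real n) x = x\<close>, of "s - 2 * h"] by (simp add: S_act_def h(2))
    moreover have "L (t, q, v) = L (- (2 * h) + 1 * t, S *v q, 1 *\<^sub>R (S *v v))" for t q v
      using assms(10)[of t q v] by (simp add: h(2))
    ultimately show ?thesis
      using second_derivative_along_lift[OF d1 d2, of "- (2 * h)" 1 S x "t + 2 * h"] x(1) by simp
  qed
  have reflect: "L'' (lift x (2 * h - t)) (0, b, b') (0, q, q')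
      = L'' (lift x t) (0, N *v b, - (N *v b')) (0, N *v q, - (N *v q'))" for t b b' q q'
  proof -
    have "x (2 * h + (- 1) * s) = N *v x s" for s
      using fun_cong[OF \<open>N_act N (T / real n) x = x\<close>, of "2 * h - s"] by (simp add: N_act_def h(2))
    moreover have "L (t, q, v) = L (2 * h + (- 1) * t, N *v q, (- 1) *\<^sub>R (N *v v))" for t q v
      using assms(11)[of t q v] by (simp add: h(2))
    ultimately show ?thesis
      using second_derivative_along_lift[OF d1 d2, of "2 * h" "- 1" N x "2 * h - t"] x(1) by simp
  qed
  have "boundary_dominated (sturm_density P Q R) (boundary_form Q) 0 h"
    by (rule boundary_dominated_of_psd[OF h(1) cont])
      (use \<open>sturm_psd_on_E2 L x (T / (2 * real n))\<close> in
        \<open>auto simp: sturm_psd_on_E2_def P_def[abs_def] Q_def[abs_def] R_def[abs_def] h_def\<close>)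
  moreover have "sturm_density P Q R (t + 2 * h) y v = sturm_density P Q R t (S *v y) (S *v v)" for t y v
    unfolding density shift ..
  moreover have bshift: "boundary_form Q (t + 2 * h) y = boundary_form Q t (S *v y)" for t y
    unfolding boundary shift by simp
  moreover have "sturm_density P Q R (2 * h - t) y v = sturm_density P Q R t (N *v y) (- (N *v v))" for t y v
    unfolding density reflect ..
  moreover have "boundary_form Q (2 * h - t) y = - boundary_form Q t (N *v y)" for t y
  proof -
    \<comment> \<open>The sign comes from the single velocity argument, which time reversal negates.\<close>
    have neg: "(0 :: real, 0 :: real^'m, - w) = - (0, 0, w)" for w :: "real^'m" by simp
    show ?thesis
      unfolding boundary reflect matrix_vector_mult_0_right minus_zero neg
      by (simp only: blinfun.minus_left blinfun.minus_right)
  qed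
  ultimately have bd: "boundary_dominated (sturm_density P Q R) (boundary_form Q) 0 T"
    unfolding h(3) using h(1) \<open>1 \<le> n\<close>
    by (intro boundary_dominated_dihedral[where A = "(*v) S" and B = "(*v) N"]
        continuous_on_sturm_density cont matrix_vector_mul_bounded_linear) auto
  have per: "boundary_form Q T y = boundary_form Q 0 y" for y
    using boundary_form_iterate[where Q = Q and c = "2 * h" and S = S, OF bshift, of 0 n y] h(3)
    by (simp add: \<open>mat_pow S n = mat 1\<close>)
  have inv: "invertible (P t)" for t
    using \<open>legendre_convex L\<close>
    by (intro invertible_of_positive) (simp add: legendre_convex_def P_def lift_def)
  have "transpose (P t) = P t" "transpose (R t) = R t" for t
    by (rule matrix_symmetric_of_inner, unfold P R, rule sym)+
  moreover have fund: "fundamental_solution (\<lambda>t. B_mat (P t) (Q t) (R t)) T \<gamma>"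
    using \<gamma> by (simp add: B_along_def[abs_def] P_def Q_def R_def)
  ultimately have "symplectic (\<gamma> T)"
    using \<open>0 < T\<close> by (intro fundamental_solution_symplectic[OF fund _ inv cont(1,2)]) auto
  moreover have "lyapunov_form (Q 0) z \<le> lyapunov_form (Q 0) (\<gamma> T *v z)" for z
    by (rule lyapunov_form_le_monodromy[OF fund _ inv cont(1,2) bd per]) (use \<open>0 < T\<close> in simp)
  ultimately have "\<not> strongly_stable_mat (\<gamma> T)"
    by (rule lyapunov_imp_not_strongly_stable)
  with stable show False by contradiction
qed

end
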